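(* Let $\{\boldsymbol{Y}_n\}=\{(\boldsymbol{X}_n,J_n)\}$ be a $d$-dimensional QBD process on $\mathbb{Z}_+^d\times S_0$ (as defined in the context), $D=\{1,\dots,d\}$. Assume that: (1) $\{\boldsymbol{Y}_n\}$ is irreducible and positive recurrent, with stationary distribution $\boldsymbol{\nu}=(\nu_{\boldsymbol{x},j};\ \boldsymbol{x}\in\mathbb{Z}_+^d,\ j\in S_0)$; (2) for every $k\in D$, the matrix $Q^{\{k\}}$ is irreducible; (3) for every $\alpha\subset D$ with $1\le|\alpha|\le d-1$ and every $k\in D\setminus\alpha$, the matrix $Q^{\alpha,\{k\}}_*(\mathbf{0}_{|\alpha|})$ is irreducible. Then for every $k\in D$, every (possibly empty) $\alpha\subset D\setminus\{k\}$, every $\boldsymbol{x}(\{k\}^C)\in\mathbb{Z}_+^{d-1}$ and every $j\in S_0$, \[ \liminf_{n\to\infty}\frac1n\log\nu_{((x(k)=n,\ \boldsymbol{x}(\{k\}^C)),\,j)}\ \ge\ -\max\left\{\theta(k);\ \boldsymbol{\theta}\in\bar\Gamma^{\{k\}\cup\alpha}\right\}. \]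
   Context: Notation: $D=\{1,\dots,d\}$; for $\alpha\subset D$, $\alpha^C=D\setminus\alpha$; for $\boldsymbol{x}\in\mathbb{R}^d$, $x(l)$ is its $l$-th element and $\boldsymbol{x}(\alpha)=(x(l),l\in\alpha)$, and one writes $\boldsymbol{x}=(\boldsymbol{x}(\alpha),\boldsymbol{x}(\alpha^C))$. For a vector $\boldsymbol{x}$ and a number $c$, "$\boldsymbol{x}=c$" (or $\boldsymbol{x}>c$) means every element equals (exceeds) $c$. $(x(k)=n,\boldsymbol{x}(\{k\}^C))$ denotes the vector with $k$-th element $n$ and remaining elements $\boldsymbol{x}(\{k\}^C)$. $\mathbf{0}_m$ is the $m$-dimensional zero vector. For a nonnegative matrix $A$ of finite or countable dimension, $\mathrm{cp}(A)=\sup\{z\ge0;\ \sum_{n\ge0}z^nA^n<\infty \text{ elementwise}\}$. The $d$-dimensional QBD process. $S_0=\{1,\dots,s_0\}$ is finite. $\{\boldsymbol{Y}_n\}=\{(\boldsymbol{X}_n,J_n)\}$ is a discrete-time Markov chain on $\mathbb{Z}_+^d\times S_0$. For $\alpha\subset D$ put $\mathbb{B}^\alpha=\{\boldsymbol{x}\in\mathbb{Z}_+^d;\ \boldsymbol{x}(\alpha)>0,\ \boldsymbol{x}(\alpha^C)=0\}$; these sets partition $\mathbb{Z}_+^d$. The transition probability matrix is $P=(P_{\boldsymbol{x},\boldsymbol{x}'};\ \boldsymbol{x},\boldsymbol{x}'\in\mathbb{Z}_+^d)$ with $s_0\times s_0$ blocks $[P_{\boldsymbol{x},\boldsymbol{x}'}]_{j,j'}=\mathbb{P}(\boldsymbol{Y}_1=(\boldsymbol{x}',j')\mid\boldsymbol{Y}_0=(\boldsymbol{x},j))$,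 such that for $\boldsymbol{x}\in\mathbb{B}^\alpha$: $P_{\boldsymbol{x},\boldsymbol{x}+\boldsymbol{l}}=A^{\alpha,\beta}_{\boldsymbol{l}}$ if $\boldsymbol{l}(\alpha)\in\{-1,0,1\}^{|\alpha|}$, $\boldsymbol{l}(\alpha^C)\in\{0,1\}^{d-|\alpha|}$ and $\boldsymbol{x}+\boldsymbol{l}\in\mathbb{B}^\beta$, and $P_{\boldsymbol{x},\boldsymbol{x}+\boldsymbol{l}}=O$ otherwise, where $A^{\alpha,\beta}_{\boldsymbol{l}}$ are nonnegative $s_0\times s_0$ matrices depending only on $\alpha,\beta,\boldsymbol{l}$ and such that $P$ is stochastic. The matrices $P^\alpha_*$ and the sets $\bar\Gamma^\alpha$. For nonempty $\alpha\subset D$ and $\boldsymbol{\theta}\in\mathbb{R}^d$, $P^\alpha_*(\boldsymbol{\theta}(\alpha))=(P^\alpha_{*,\boldsymbol{x}(\alpha^C),\boldsymbol{x}'(\alpha^C)}(\boldsymbol{\theta}(\alpha));\ \boldsymbol{x}(\alpha^C),\boldsymbol{x}'(\alpha^C)\in\mathbb{Z}_+^{d-|\alpha|})$ with $s_0\times s_0$ blocks \[ P^\alpha_{*,\boldsymbol{x}(\alpha^C),\boldsymbol{x}'(\alpha^C)}(\boldsymbol{\theta}(\alpha))=\sum_{\boldsymbol{l}(\alpha)\in\{-1,0,1\}^{|\alpha|}}e^{\langle\boldsymbol{l}(\alpha),\boldsymbol{\theta}(\alpha)\rangle}P_{(\boldsymbol{x}(\alpha)=2,\,\boldsymbol{x}(\alpha^C)),\,(\boldsymbol{x}'(\alpha)=\boldsymbol{x}(\alpha)+\boldsymbol{l}(\alpha),\,\boldsymbol{x}'(\alpha^C))},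 \] where $\langle\cdot,\cdot\rangle$ is the inner product (for $\alpha=D$ this is a single $s_0\times s_0$ matrix). Put $\bar\Gamma^\alpha=\{\boldsymbol{\theta}\in\mathbb{R}^d;\ \mathrm{cp}(P^\alpha_*(\boldsymbol{\theta}(\alpha)))^{-1}\le1\}$. The truncations. For $k\in D$ and $l\in\{-1,0,1\}$ let $P^{\{k\}}_l=(P_{\boldsymbol{x},\boldsymbol{x}'};\ x(k)=2,\ x'(k)=2+l,\ \boldsymbol{x}(\{k\}^C),\boldsymbol{x}'(\{k\}^C)\in\mathbb{Z}_+^{d-1})$, and let $Q^{\{k\}}$ be the semi-infinite block tri-diagonal matrix (block rows and columns indexed by $\mathbb{Z}_+$) with all diagonal blocks $P^{\{k\}}_0$, all superdiagonal blocks $P^{\{k\}}_1$ and all subdiagonal blocks $P^{\{k\}}_{-1}$. For $\alpha\subset D$ with $1\le|\alpha|\le d-1$, $k\in D\setminus\alpha$ and $l\in\{-1,0,1\}$ let $P^{\alpha,\{k\}}_{*,l}(\boldsymbol{\theta}(\alpha))=(P^\alpha_{*,\boldsymbol{x}(\alpha^C),\boldsymbol{x}'(\alpha^C)}(\boldsymbol{\theta}(\alpha));\ x(k)=2,\ x'(k)=2+l,\ \boldsymbol{x}(\alpha^C\setminus\{k\}),\boldsymbol{x}'(\alpha^C\setminus\{k\})\in\mathbb{Z}_+^{d-|\alpha|-1})$, and let $Q^{\alpha,\{k\}}_*(\boldsymbol{\theta}(\alpha))$ be the semi-infinite block tri-diagonal matrix with all diagonal blocks $P^{\alpha,\{k\}}_{*,0}(\boldsymbol{\theta}(\alpha))$,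 all superdiagonal blocks $P^{\alpha,\{k\}}_{*,1}(\boldsymbol{\theta}(\alpha))$ and all subdiagonal blocks $P^{\alpha,\{k\}}_{*,-1}(\boldsymbol{\theta}(\alpha))$. *)

theory Defs
  imports "HOL-Probability.Probability"
begin

section \<open>Nonnegative matrices of countable dimension\<close>

text \<open>
  A matrix is a function of a row and a column index, relevant only on an index set \<open>I\<close>.
  Powers have entries in \<^typ>\<open>ennreal\<close>, so that infinite sums need no convergence condition.
\<close>

primrec mat_pow :: "'i set \<Rightarrow> ('i \<Rightarrow> 'i \<Rightarrow> real) \<Rightarrow> nat \<Rightarrow> 'i \<Rightarrow> 'i \<Rightarrow> ennreal" where
  "mat_pow I A 0 = (\<lambda>i j. if i = j then 1 else 0)"
| "mat_pow I A (Suc n) = (\<lambda>i j. \<Sum>\<^sub>\<infinity>h\<in>I. ennreal (A i h) * mat_pow I A n h j)"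

definition irreducible_mat :: "'i set \<Rightarrow> ('i \<Rightarrow> 'i \<Rightarrow> real) \<Rightarrow> bool" where
  "irreducible_mat I A \<longleftrightarrow> (\<forall>i\<in>I. \<forall>j\<in>I. \<exists>n. mat_pow I A n i j > 0)"

definition stochastic_mat :: "('i \<Rightarrow> 'i \<Rightarrow> real) \<Rightarrow> bool" where
  "stochastic_mat A \<longleftrightarrow> (\<forall>i j. 0 \<le> A i j) \<and> (\<forall>i. (A i has_sum 1) UNIV)"

text \<open>The convergence parameter, a value in $[0,\infty]$.\<close>

definition cp :: "'i set \<Rightarrow> ('i \<Rightarrow> 'i \<Rightarrow> real) \<Rightarrow> ennreal" where
  "cp I A = Sup {ennreal z | z. 0 \<le> z \<and>
     (\<forall>i\<in>I. \<forall>j\<in>I. (\<Sum>n. ennreal (z ^ n) * mat_pow I A n i j) < \<infinity>)}"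

text \<open>
  The semi-infinite block tri-diagonal matrix whose diagonal, superdiagonal and subdiagonal
  blocks are \<open>B 0\<close>, \<open>B 1\<close> and \<open>B (-1)\<close>.
\<close>

definition block_tridiag ::
    "(int \<Rightarrow> 'i \<Rightarrow> 'i \<Rightarrow> real) \<Rightarrow> nat \<times> 'i \<Rightarrow> nat \<times> 'i \<Rightarrow> real" where
  "block_tridiag B = (\<lambda>(m, i) (m', i').
     if int m' - int m \<in> {-1, 0, 1} then B (int m' - int m) i i' else 0)"


section \<open>Markov chains\<close>

text \<open>
  \<open>M y\<close> is the law under which the chain \<open>Y\<close> starts from \<open>y\<close>; an expectation conditional on
  the initial state being \<open>y\<close> is an integral with respect to \<open>M y\<close>.
\<close>

definition markov_chain ::
    "('y \<Rightarrow> 'w measure) \<Rightarrow> (nat \<Rightarrow> 'w \<Rightarrow> 'y) \<Rightarrow> ('y \<Rightarrow> 'y \<Rightarrow> real) \<Rightarrow> bool" where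
  "markov_chain M Y P \<longleftrightarrow> (\<forall>y.
     prob_space (M y) \<and>
     (\<forall>n. Y n \<in> measurable (M y) (count_space UNIV)) \<and>
     (AE w in M y. Y 0 w = y) \<and>
     (\<forall>n p y'. \<P>(w in M y. \<forall>m\<le>n. Y m w = p m) > 0 \<longrightarrow>
        \<P>(w in M y. Y (Suc n) w = y' \<bar> \<forall>m\<le>n. Y m w = p m) = P (p n) y'))"

text \<open>The infimum is \<open>\<infinity>\<close> if the chain never returns to \<open>y\<close>.\<close>

definition return_time :: "(nat \<Rightarrow> 'w \<Rightarrow> 'y) \<Rightarrow> 'y \<Rightarrow> 'w \<Rightarrow> ennreal" where
  "return_time Y y w = (INF n\<in>{n. 1 \<le> n \<and> Y n w = y}. of_nat n)"

definition positive_recurrent :: "('y \<Rightarrow> 'w measure) \<Rightarrow> (nat \<Rightarrow> 'w \<Rightarrow> 'y) \<Rightarrow> bool" where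
  "positive_recurrent M Y \<longleftrightarrow> (\<forall>y. (\<integral>\<^sup>+ w. return_time Y y w \<partial>M y) < \<infinity>)"

definition stationary_distribution :: "('y \<Rightarrow> 'y \<Rightarrow> real) \<Rightarrow> ('y \<Rightarrow> real) \<Rightarrow> bool" where
  "stationary_distribution P \<nu> \<longleftrightarrow>
     (\<forall>y. 0 \<le> \<nu> y) \<and> (\<nu> has_sum 1) UNIV \<and>
     (\<forall>y'. ((\<lambda>y. \<nu> y * P y y') has_sum \<nu> y') UNIV)"


section \<open>Multidimensional QBD processes\<close>

text \<open>
  The index set $D$ is the finite type \<open>'d\<close> and the phase set $S_0$ the finite type \<open>'s\<close>.
\<close>

type_synonym ('d, 's) state = "('d \<Rightarrow> nat) \<times> 's"

definition face :: "'d set \<Rightarrow> ('d \<Rightarrow> nat) set" where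
  "face \<alpha> = {x. (\<forall>i\<in>\<alpha>. x i > 0) \<and> (\<forall>i\<in>-\<alpha>. x i = 0)}"

definition qbd_matrix ::
    "(('d::finite, 's::finite) state \<Rightarrow> ('d, 's) state \<Rightarrow> real) \<Rightarrow> bool" where
  "qbd_matrix P \<longleftrightarrow> stochastic_mat P \<and>
     (\<exists>A :: 'd set \<Rightarrow> 'd set \<Rightarrow> ('d \<Rightarrow> int) \<Rightarrow> real ^ 's ^ 's.
        (\<forall>\<alpha> \<beta> l j j'. 0 \<le> A \<alpha> \<beta> l $ j $ j') \<and>
        (\<forall>\<alpha> \<beta>. \<forall>x\<in>face \<alpha>. \<forall>x'\<in>face \<beta>. \<forall>j j'.
           let l = (\<lambda>i. int (x' i) - int (x i)) in
           P (x, j) (x', j') =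
             (if (\<forall>i\<in>\<alpha>. l i \<in> {-1, 0, 1}) \<and> (\<forall>i\<in>-\<alpha>. l i \<in> {0, 1})
              then A \<alpha> \<beta> l $ j $ j' else 0)))"

text \<open>
  Row and column indices $(\mathbf{x}(\beta), j)$ with $\mathbf{x}(\beta)$ in
  $\mathbb{Z}_+^{|\beta|}$; a subvector is an extensional function on \<open>\<beta>\<close>. For empty \<open>\<beta>\<close>
  there is exactly one subvector.
\<close>

definition indices :: "'d set \<Rightarrow> ('d, 's) state set" where
  "indices \<beta> = (\<beta> \<rightarrow>\<^sub>E UNIV) \<times> UNIV"

text \<open>
  The matrix $P^\alpha_*(\theta(\alpha))$, on \<open>indices (-\<alpha>)\<close>; only the components of \<open>\<theta>\<close> in
  \<open>\<alpha>\<close> enter.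
\<close>

definition P_star ::
    "(('d::finite, 's::finite) state \<Rightarrow> ('d, 's) state \<Rightarrow> real) \<Rightarrow> 'd set \<Rightarrow> real ^ 'd
       \<Rightarrow> ('d, 's) state \<Rightarrow> ('d, 's) state \<Rightarrow> real" where
  "P_star P \<alpha> \<theta> = (\<lambda>(u, j) (u', j').
     \<Sum>l\<in>\<alpha> \<rightarrow>\<^sub>E {-1, 0, 1::int}.
       exp (\<Sum>i\<in>\<alpha>. of_int (l i) * \<theta> $ i) *
       P (override_on u (\<lambda>i. 2) \<alpha>, j) (override_on u' (\<lambda>i. nat (2 + l i)) \<alpha>, j'))"

definition Gamma_bar ::
    "(('d::finite, 's::finite) state \<Rightarrow> ('d, 's) state \<Rightarrow> real) \<Rightarrow> 'd set \<Rightarrow> (real ^ 'd) set" where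
  "Gamma_bar P \<alpha> = {\<theta>. inverse (cp (indices (-\<alpha>)) (P_star P \<alpha> \<theta>)) \<le> 1}"

text \<open>
  The block of \<open>R\<close> with $x(k) = 2$ in the rows and $x'(k) = 2 + l$ in the columns. If \<open>R\<close> is a
  matrix on \<open>indices \<beta>\<close> and \<open>k \<in> \<beta>\<close>, this is a matrix on \<open>indices (\<beta> - {k})\<close>.
\<close>

definition level_block ::
    "(('d, 's) state \<Rightarrow> ('d, 's) state \<Rightarrow> real) \<Rightarrow> 'd \<Rightarrow> int
       \<Rightarrow> ('d, 's) state \<Rightarrow> ('d, 's) state \<Rightarrow> real" where
  "level_block R k l = (\<lambda>(u, j) (u', j'). R (u(k := 2), j) (u'(k := nat (2 + l)), j'))"

definition Q_mat ::
    "(('d, 's) state \<Rightarrow> ('d, 's) state \<Rightarrow> real) \<Rightarrow> 'd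
       \<Rightarrow> nat \<times> ('d, 's) state \<Rightarrow> nat \<times> ('d, 's) state \<Rightarrow> real" where
  "Q_mat P k = block_tridiag (level_block P k)"

definition Q_star ::
    "(('d::finite, 's::finite) state \<Rightarrow> ('d, 's) state \<Rightarrow> real) \<Rightarrow> 'd set \<Rightarrow> 'd \<Rightarrow> real ^ 'd
       \<Rightarrow> nat \<times> ('d, 's) state \<Rightarrow> nat \<times> ('d, 's) state \<Rightarrow> real" where
  "Q_star P \<alpha> k \<theta> = block_tridiag (level_block (P_star P \<alpha> \<theta>) k)"

end

theory Submission
  imports Defs
begin

text \<open>
  Put $\beta = \{k\} \cup \alpha$ and fix the coordinates outside $\beta$ and the phase. A loop of
  the process that stays off the boundary in the $\beta$ directions, displaces $\mathbf{x}(\beta)$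
  by \<open>L\<close> and has probability at least $e^{-g}$ can be repeated, so these pairs \<open>(L, g)\<close> form an
  additive semigroup. If \<open>\<theta>\<close> satisfies $\langle \theta, L \rangle \le g$ for all of them, then the
  diagonal entries of the powers of $P^\beta_*(\theta(\beta))$ grow only polynomially, so
  $\theta \in \bar\Gamma^\beta$.

  Conversely, repeating a loop with \<open>L\<close> close to $N e_k$ gives the lower bound
  $-(g + C |N e_k - L|) / N$ for the decay rate in direction \<open>k\<close>. Here \<open>C\<close> prices the corrections:
  the coordinates in \<open>\<beta>\<close> are first raised and finally lowered one after the other by loops whose
  effect on the coordinates treated before is linearly bounded. If the decay rate were below
  \<open>-\<rho>\<close>, then $g + C |N e_k - L| \ge \rho N$ for all loops, and separating
  a point from a closed convex cone yields some \<open>\<theta>\<close> as above with \<open>\<theta> $ k\<close> arbitrarily close to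
  \<open>\<rho>\<close>.
\<close>

section \<open>Countable sums and matrix powers\<close>

text \<open>The obstacle is the boundary. Irreducibility of \<open>P\<close> yields paths that may
  use boundary transitions, and such paths cannot be translated. The matrices \<open>Q_star\<close>
  use interior transitions in the directions of \<open>k\<close> and \<alpha> at every level, so
  their paths are paths of the process that may be translated upwards. The price is a displacement
  of the coordinates in \<alpha> that is fixed but cannot be chosen; this is why coordinates are
  moved one at a time. The term C |N e_k - L| has the following origin. After n / N repetitions of a
  loop the process is about (n / N) |N e_k - L| away from its target, and a correction costs at most
  linearly in that distance. Dividing by n leaves this term in the rate, while costs that do not
  grow with n disappear. One \<open>C\<close> has to serve all loops, because it enters the cone
  that is separated from a point: the penalty \<open>C * norm (v - L)\<close> extends the loop costs
  to a cost of every displacement \<open>v\<close>. Since this cost is finite everywhere, the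
  separating hyperplane is not vertical and has a slope \<theta>.\<close>

lemma sum_le_infsum_ennreal:
  fixes f :: "'i \<Rightarrow> ennreal"
  assumes "finite F" "F \<subseteq> A"
  shows "sum f F \<le> infsum f A"
  using assms by (subst nonneg_infsum_complete) (auto intro!: SUP_upper)

lemma infsum_ennreal_le:
  fixes f :: "'i \<Rightarrow> ennreal"
  assumes "\<And>F. finite F \<Longrightarrow> F \<subseteq> A \<Longrightarrow> sum f F \<le> b"
  shows "infsum f A \<le> b"
  using assms by (subst nonneg_infsum_complete) (auto intro!: SUP_least)

lemma elem_le_infsum_ennreal:
  fixes f :: "'i \<Rightarrow> ennreal"
  assumes "a \<in> A"
  shows "f a \<le> infsum f A"
  using sum_le_infsum_ennreal[of "{a}" A f] assms by simp

lemma infsum_ennreal_pos_iff: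
  fixes f :: "'i \<Rightarrow> ennreal"
  shows "0 < infsum f A \<longleftrightarrow> (\<exists>a\<in>A. 0 < f a)"
proof
  assume "0 < infsum f A"
  then show "\<exists>a\<in>A. 0 < f a"
    by (metis infsum_0 less_irrefl not_gr_zero)
next
  assume "\<exists>a\<in>A. 0 < f a"
  then show "0 < infsum f A"
    using elem_le_infsum_ennreal[of _ A f] by (meson less_le_trans)
qed

lemma infsum_mono_ennreal:
  fixes f g :: "'i \<Rightarrow> ennreal"
  assumes "\<And>a. a \<in> A \<Longrightarrow> f a \<le> g a"
  shows "infsum f A \<le> infsum g A"
  by (rule infsum_ennreal_le, rule order_trans[OF sum_mono sum_le_infsum_ennreal])
     (use assms in auto)

lemma infsum_cmult_right_ennreal:
  fixes f :: "'i \<Rightarrow> ennreal"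
  shows "(\<Sum>\<^sub>\<infinity>a\<in>A. c * f a) = c * infsum f A"
proof -
  have ne: "{F. finite F \<and> F \<subseteq> A} \<noteq> {}" by blast
  show ?thesis
    by (subst (1 2) nonneg_infsum_complete)
       (simp_all add: sum_distrib_left[symmetric] SUP_mult_left_ennreal)
qed

lemma sum_infsum_ennreal:
  fixes f :: "'a \<Rightarrow> 'b \<Rightarrow> ennreal"
  assumes "finite F"
  shows "(\<Sum>a\<in>F. \<Sum>\<^sub>\<infinity>b\<in>B. f a b) = (\<Sum>\<^sub>\<infinity>b\<in>B. \<Sum>a\<in>F. f a b)"
  using assms
proof (induction F)
  case (insert a F)
  then show ?case
    by (simp add: infsum_add nonneg_summable_on_complete)
qed simp

text \<open>Only the paths through \<open>h\<close> at time \<open>n\<close> are kept. This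
  one-sided Chapman-Kolmogorov bound is all that path constructions need, and its induction
  exchanges no infinite sums.\<close>

lemma mat_pow_add_ge:
  assumes "h \<in> I"
  shows "mat_pow I A n i h * mat_pow I A m h j \<le> mat_pow I A (n + m) i j"
proof (induction n arbitrary: i)
  case 0
  show ?case by simp
next
  case (Suc n)
  have "mat_pow I A (Suc n) i h * mat_pow I A m h j =
      (\<Sum>\<^sub>\<infinity>g\<in>I. ennreal (A i g) * (mat_pow I A n g h * mat_pow I A m h j))"
    by (simp add: mult.commute[of _ "mat_pow I A m h j"] infsum_cmult_right_ennreal[symmetric] ac_simps)
  also have "\<dots> \<le> mat_pow I A (Suc n + m) i j"
    using Suc by (auto intro!: infsum_mono_ennreal mult_left_mono)
  finally show ?case .
qed

lemma mat_pow_Suc_ge: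
  assumes "h \<in> I"
  shows "ennreal (A i h) * mat_pow I A n h j \<le> mat_pow I A (Suc n) i j"
  using elem_le_infsum_ennreal[OF assms, of "\<lambda>h. ennreal (A i h) * mat_pow I A n h j"] by simp

lemma mat_pow_Suc_posE:
  assumes "0 < mat_pow I A (Suc n) i j"
  obtains h where "h \<in> I" "0 < A i h" "0 < mat_pow I A n h j"
  using assms by (auto simp: infsum_ennreal_pos_iff ennreal_zero_less_mult_iff)

text \<open>A positive entry of a power means that a path exists, and a map that preserves edges
  maps paths to paths. The map may identify indices; it serves to forget the level of a tridiagonal
  matrix.\<close>

lemma mat_pow_map_pos:
  assumes "\<And>a b. a \<in> I \<Longrightarrow> b \<in> I \<Longrightarrow> 0 < A a b \<Longrightarrow> 0 < B (f a) (f b)"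
    and "f ` I \<subseteq> J" "i \<in> I" "j \<in> I"
    and "0 < mat_pow I A n i j"
  shows "0 < mat_pow J B n (f i) (f j)"
  using assms(3,5)
proof (induction n arbitrary: i)
  case 0
  then show ?case by (auto split: if_splits)
next
  case (Suc n)
  then obtain h where h: "h \<in> I" "0 < A i h" "0 < mat_pow I A n h j"
    by (blast elim: mat_pow_Suc_posE)
  then have "0 < ennreal (B (f i) (f h)) * mat_pow J B n (f h) (f j)"
    using assms(1) Suc by (auto simp: ennreal_zero_less_mult_iff)
  also have "\<dots> \<le> mat_pow J B (Suc n) (f i) (f j)"
    using h assms(2) by (intro mat_pow_Suc_ge) auto
  finally show ?case .
qed

section \<open>Stochastic matrices and invariance of \<nu> under powers\<close>

lemma mat_pow_stochastic_le_1:
  assumes "stochastic_mat A"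
  shows "mat_pow UNIV A n i j \<le> 1"
proof (induction n arbitrary: i)
  case (Suc n)
  have "mat_pow UNIV A (Suc n) i j \<le> (\<Sum>\<^sub>\<infinity>h. ennreal (A i h))"
    using Suc by (auto intro!: infsum_mono_ennreal mult_left_le)
  also have "\<dots> \<le> 1"
  proof (rule infsum_ennreal_le)
    fix F :: "'a set" assume F: "finite F"
    have "sum (A i) F \<le> 1"
      using assms F by (intro finite_sum_le_has_sum) (auto simp: stochastic_mat_def)
    moreover have "(\<Sum>h\<in>F. ennreal (A i h)) = ennreal (sum (A i) F)"
      using assms by (intro sum_ennreal) (auto simp: stochastic_mat_def)
    ultimately show "(\<Sum>h\<in>F. ennreal (A i h)) \<le> 1"
      by (simp add: ennreal_le_1)
  qed
  finally show ?case .
qed simp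

text \<open>With finite partial sums on the left, only a finite sum has to be pulled through the sum
  over \<open>h\<close>; the induction hypothesis for all finite sets then bounds the remaining
  infinite sum.\<close>

lemma stationary_sum_mat_pow_le:
  assumes "stochastic_mat P" "stationary_distribution P \<nu>" "finite F"
  shows "(\<Sum>y\<in>F. ennreal (\<nu> y) * mat_pow UNIV P n y y') \<le> ennreal (\<nu> y')"
  using assms(3)
proof (induction n arbitrary: F)
  case 0
  have "(\<Sum>y\<in>F. ennreal (\<nu> y) * mat_pow UNIV P 0 y y') =
      (\<Sum>y\<in>F. if y = y' then ennreal (\<nu> y') else 0)"
    by (intro sum.cong) auto
  also have "\<dots> \<le> ennreal (\<nu> y')"
    using 0 by simp
  finally show ?case .
next
  case (Suc n)
  have nn: "0 \<le> \<nu> y" "0 \<le> P y z" for y z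
    using assms by (auto simp: stationary_distribution_def stochastic_mat_def)
  have "(\<Sum>y\<in>F. ennreal (\<nu> y) * mat_pow UNIV P (Suc n) y y') =
      (\<Sum>\<^sub>\<infinity>h. \<Sum>y\<in>F. ennreal (\<nu> y) * (ennreal (P y h) * mat_pow UNIV P n h y'))"
    using Suc.prems by (simp add: infsum_cmult_right_ennreal[symmetric] sum_infsum_ennreal)
  also have "\<dots> \<le> (\<Sum>\<^sub>\<infinity>h. ennreal (\<nu> h) * mat_pow UNIV P n h y')"
  proof (rule infsum_mono_ennreal)
    fix h
    have "(\<Sum>y\<in>F. \<nu> y * P y h) \<le> \<nu> h"
      using assms nn Suc.prems
      by (intro finite_sum_le_has_sum[where f = "\<lambda>y. \<nu> y * P y h"]) (auto simp: stationary_distribution_def)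
    then have "(\<Sum>y\<in>F. ennreal (\<nu> y * P y h)) \<le> ennreal (\<nu> h)"
      using nn by (simp add: ennreal_leI)
    moreover have "(\<Sum>y\<in>F. ennreal (\<nu> y) * (ennreal (P y h) * mat_pow UNIV P n h y')) =
        (\<Sum>y\<in>F. ennreal (\<nu> y * P y h)) * mat_pow UNIV P n h y'"
      using nn by (simp add: sum_distrib_right ennreal_mult mult.assoc)
    ultimately show "(\<Sum>y\<in>F. ennreal (\<nu> y) * (ennreal (P y h) * mat_pow UNIV P n h y'))
        \<le> ennreal (\<nu> h) * mat_pow UNIV P n h y'"
      by (simp add: mult_right_mono)
  qed
  also have "\<dots> \<le> ennreal (\<nu> y')"
    using Suc.IH by (intro infsum_ennreal_le)
  finally show ?case .
qed

lemma stationary_mat_pow_le: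
  assumes "stochastic_mat P" "stationary_distribution P \<nu>"
  shows "ennreal (\<nu> y) * mat_pow UNIV P n y y' \<le> ennreal (\<nu> y')"
  using stationary_sum_mat_pow_le[OF assms, of "{y}"] by simp

lemma stationary_pos:
  assumes "stochastic_mat P" "stationary_distribution P \<nu>" "irreducible_mat UNIV P"
  shows "0 < \<nu> y"
proof -
  have "\<exists>y. 0 < \<nu> y"
  proof (rule ccontr)
    assume "\<not> ?thesis"
    then have "\<nu> = (\<lambda>_. 0)"
      using assms(2) by (intro ext antisym) (auto simp: stationary_distribution_def not_less)
    then have "(\<nu> has_sum 0) UNIV" by simp
    then show False
      using assms(2) has_sum_unique by (fastforce simp: stationary_distribution_def)
  qed
  then obtain z where "0 < \<nu> z" by blast
  moreover obtain n where "0 < mat_pow UNIV P n z y"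
    using assms(3) by (auto simp: irreducible_mat_def)
  ultimately have "0 < ennreal (\<nu> z) * mat_pow UNIV P n z y"
    by (simp add: ennreal_zero_less_mult_iff)
  also have "\<dots> \<le> ennreal (\<nu> y)" by (rule stationary_mat_pow_le[OF assms(1,2)])
  finally show ?thesis by simp
qed

section \<open>Costs of paths\<close>

text \<open>
  The number of steps is left open: only the exponential rate of the best path matters.
\<close>

definition cost_le :: "('y \<Rightarrow> 'y \<Rightarrow> real) \<Rightarrow> real \<Rightarrow> 'y \<Rightarrow> 'y \<Rightarrow> bool" where
  "cost_le P c y y' \<longleftrightarrow> (\<exists>n. ennreal (exp (- c)) \<le> mat_pow UNIV P n y y')"

lemma cost_le_refl: "cost_le P 0 y y"
  unfolding cost_le_def by (intro exI[of _ 0]) simp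

lemma cost_le_trans:
  assumes "cost_le P c x y" "cost_le P d y z"
  shows "cost_le P (c + d) x z"
proof -
  obtain n m where "ennreal (exp (- c)) \<le> mat_pow UNIV P n x y"
      "ennreal (exp (- d)) \<le> mat_pow UNIV P m y z"
    using assms by (auto simp: cost_le_def)
  then have "ennreal (exp (- c)) * ennreal (exp (- d)) \<le> mat_pow UNIV P n x y * mat_pow UNIV P m y z"
    by (rule mult_mono') auto
  also have "\<dots> \<le> mat_pow UNIV P (n + m) x z" by (rule mat_pow_add_ge) simp
  also have "ennreal (exp (- c)) * ennreal (exp (- d)) = ennreal (exp (- (c + d)))"
    by (simp add: ennreal_mult[symmetric] exp_add[symmetric])
  finally show ?thesis by (auto simp: cost_le_def)
qed

lemma cost_le_mono: "cost_le P c y y' \<Longrightarrow> c \<le> d \<Longrightarrow> cost_le P d y y'"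
  unfolding cost_le_def by (meson ennreal_leI exp_le_cancel_iff neg_le_iff_le order_trans)

lemma cost_le_step:
  assumes "p \<le> P y y'" "0 < p"
  shows "cost_le P (- ln p) y y'"
proof -
  have "ennreal p \<le> ennreal (P y y')" using assms by (intro ennreal_leI)
  also have "\<dots> \<le> mat_pow UNIV P (Suc 0) y y'"
    using mat_pow_Suc_ge[of y' UNIV P y 0 y'] by simp
  finally show ?thesis using assms(2) by (auto simp: cost_le_def simp del: mat_pow.simps)
qed

lemma cost_le_nonneg:
  assumes "cost_le P c y y'" "stochastic_mat P"
  shows "0 \<le> c"
proof -
  obtain n where "ennreal (exp (- c)) \<le> mat_pow UNIV P n y y'"
    using assms by (auto simp: cost_le_def)
  also have "\<dots> \<le> 1" using assms by (intro mat_pow_stochastic_le_1)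
  finally show ?thesis by (simp add: ennreal_le_1)
qed

lemma cost_le_iterate:
  assumes "\<And>r. r < R \<Longrightarrow> cost_le P c (f r) (f (Suc r))"
  shows "cost_le P (real R * c) (f 0) (f R)"
  using assms
proof (induction R)
  case (Suc R)
  then have "cost_le P (real R * c + c) (f 0) (f (Suc R))"
    by (intro cost_le_trans[of P _ _ "f R"]) auto
  then show ?case by (simp add: algebra_simps)
qed (simp add: cost_le_refl)

text \<open>The link between paths and \<nu>: the mass at \<open>y\<close> transported along one
  cheap path already bounds \<nu> at \<open>y'\<close> from below.\<close>

lemma stationary_cost_le:
  assumes "stochastic_mat P" "stationary_distribution P \<nu>" "irreducible_mat UNIV P"
    and "cost_le P c y y'"
  shows "ln (\<nu> y) - c \<le> ln (\<nu> y')"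
proof -
  have pos: "0 < \<nu> y" "0 < \<nu> y'" using stationary_pos[OF assms(1-3)] by auto
  obtain n where "ennreal (exp (- c)) \<le> mat_pow UNIV P n y y'"
    using assms by (auto simp: cost_le_def)
  then have "ennreal (\<nu> y) * ennreal (exp (- c)) \<le> ennreal (\<nu> y) * mat_pow UNIV P n y y'"
    by (rule mult_left_mono) simp
  also have "\<dots> \<le> ennreal (\<nu> y')" by (rule stationary_mat_pow_le[OF assms(1,2)])
  finally have "\<nu> y * exp (- c) \<le> \<nu> y'"
    using pos by (simp add: ennreal_mult[symmetric])
  then have "ln (\<nu> y * exp (- c)) \<le> ln (\<nu> y')"
    using pos by (subst ln_le_cancel_iff) auto
  then show ?thesis using pos by (simp add: ln_mult)
qed

section \<open>Linear minorants\<close>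

text \<open>The set under the closure is the cone generated by the semigroup \<open>A\<close> over
  the nonnegative rationals. Density of the rationals turns its closure into a cone over the
  nonnegative reals, and a cone closed under addition is convex.\<close>

lemma convex_closure_divisible_hull:
  fixes A :: "'a::euclidean_space set"
  assumes zero: "0 \<in> A" and add: "\<And>x y. x \<in> A \<Longrightarrow> y \<in> A \<Longrightarrow> x + y \<in> A"
  shows "convex (closure {x. \<exists>m::nat. 1 \<le> m \<and> real m *\<^sub>R x \<in> A})"
proof -
  define E where "E = {x. \<exists>m::nat. 1 \<le> m \<and> real m *\<^sub>R x \<in> A}"
  have mult: "real n *\<^sub>R x \<in> A" if "x \<in> A" for n x
    using that by (induction n) (auto simp: zero algebra_simps intro: add)
  have E_add: "x + y \<in> E" if xy: "x \<in> E" "y \<in> E" for x y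
  proof -
    obtain m n :: nat where mn: "1 \<le> m" "1 \<le> n" "real m *\<^sub>R x \<in> A" "real n *\<^sub>R y \<in> A"
      using xy by (auto simp: E_def)
    \<comment> \<open>The common multiple \<open>m * n\<close> of the two denominators clears both
      at once.\<close>
    have "real (m * n) *\<^sub>R (x + y) = real n *\<^sub>R (real m *\<^sub>R x) + real m *\<^sub>R (real n *\<^sub>R y)"
      by (simp add: algebra_simps)
    also have "\<dots> \<in> A" by (rule add[OF mult[OF mn(3)] mult[OF mn(4)]])
    finally show ?thesis using mn by (auto simp: E_def intro!: exI[of _ "m * n"])
  qed
  have E_rat: "(real p / real (Suc q)) *\<^sub>R x \<in> E" if x: "x \<in> E" for p q x
  proof -
    obtain m :: nat where m: "1 \<le> m" "real m *\<^sub>R x \<in> A"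
      using x by (auto simp: E_def)
    have cancel: "s * a * (b / s) = b * a" if "s \<noteq> 0" for s a b :: real
      using that by simp
    have "real (Suc q * m) *\<^sub>R ((real p / real (Suc q)) *\<^sub>R x) = real p *\<^sub>R (real m *\<^sub>R x)"
      unfolding scaleR_scaleR of_nat_mult by (subst cancel) auto
    also have "\<dots> \<in> A" by (rule mult[OF m(2)])
    finally show ?thesis unfolding E_def using m by (auto intro!: exI[of _ "Suc q * m"])
  qed
  have E_scale: "t *\<^sub>R x \<in> closure E" if x: "x \<in> E" and t: "0 \<le> t" for x and t :: real
  proof -
    have bound: "t - 1 / s \<le> b / s" if "0 < s" "s * t - 1 \<le> b" for s b :: real
      using that divide_right_mono[of "s * t - 1" b s] by (simp add: diff_divide_distrib)
    \<comment> \<open>The rationals floor((q+1) t) / (q+1) approximate the real factor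
      \<open>t\<close> from below; \<open>Suc q\<close> keeps the denominators positive.\<close>
    have "(\<lambda>q. real (nat \<lfloor>real (Suc q) * t\<rfloor>) / real (Suc q)) \<longlonglongrightarrow> t"
    proof (rule tendsto_sandwich[of "\<lambda>q. t - 1 / real (Suc q)" _ _ "\<lambda>q. t"])
      show "\<forall>\<^sub>F q in sequentially. t - 1 / real (Suc q) \<le> real (nat \<lfloor>real (Suc q) * t\<rfloor>) / real (Suc q)"
      proof (rule always_eventually, rule allI)
        fix q
        have "real (Suc q) * t - 1 \<le> real (nat \<lfloor>real (Suc q) * t\<rfloor>)"
          using t by linarith
        then show "t - 1 / real (Suc q) \<le> real (nat \<lfloor>real (Suc q) * t\<rfloor>) / real (Suc q)"
          by (intro bound) simp_all
      qed
      show "\<forall>\<^sub>F q in sequentially. real (nat \<lfloor>real (Suc q) * t\<rfloor>) / real (Suc q) \<le> t"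
      proof (rule always_eventually, rule allI)
        fix q
        have "real (nat \<lfloor>real (Suc q) * t\<rfloor>) \<le> real (Suc q) * t"
          using t by (simp add: of_nat_nat del: of_nat_Suc)
        then show "real (nat \<lfloor>real (Suc q) * t\<rfloor>) / real (Suc q) \<le> t"
          by (simp add: field_simps del: of_nat_Suc)
      qed
      show "(\<lambda>q. t - 1 / real (Suc q)) \<longlonglongrightarrow> t"
        using tendsto_diff[OF tendsto_const LIMSEQ_inverse_real_of_nat, of t]
        by (simp add: inverse_eq_divide)
    qed simp
    then have lim: "(\<lambda>q. (real (nat \<lfloor>real (Suc q) * t\<rfloor>) / real (Suc q)) *\<^sub>R x) \<longlonglongrightarrow> t *\<^sub>R x"
      by (intro tendsto_scaleR tendsto_const)
    have mem: "\<forall>q. (real (nat \<lfloor>real (Suc q) * t\<rfloor>) / real (Suc q)) *\<^sub>R x \<in> E"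
      using x by (intro allI E_rat)
    show ?thesis
      unfolding closure_sequential by (rule exI, rule conjI[OF mem lim])
  qed
  have scale: "t *\<^sub>R x \<in> closure E" if x: "x \<in> closure E" and t: "0 \<le> t" for x and t :: real
  proof -
    \<comment> \<open>Scaling is continuous and sends \<open>E\<close> into the closed set
      \<open>closure E\<close>, hence also the closure of \<open>E\<close>.\<close>
    have "(*\<^sub>R) t ` closure E \<subseteq> closure E"
      using t E_scale by (intro image_closure_subset) (auto intro!: continuous_intros)
    then show ?thesis using x by blast
  qed
  have plus: "x + y \<in> closure E" if xy: "x \<in> closure E" "y \<in> closure E" for x y
  proof -
    obtain f g where "\<forall>n. f n \<in> E" "f \<longlonglongrightarrow> x" "\<forall>n. g n \<in> E" "g \<longlonglongrightarrow> y"
      using xy unfolding closure_sequential by blast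
    then have "\<forall>n. f n + g n \<in> E" "(\<lambda>n. f n + g n) \<longlonglongrightarrow> x + y"
      using E_add by (auto intro: tendsto_add)
    then show ?thesis
      unfolding closure_sequential by (intro exI[of _ "\<lambda>n. f n + g n"] conjI)
  qed
  show ?thesis
    unfolding E_def[symmetric] convex_def using plus scale by auto
qed

text \<open>Hahn-Banach separation for a cost known only on a semigroup. By \<open>lower\<close>,
  the penalised cost per unit of moving along \<open>e\<close> is at least \<rho>, so the point
  \<open>(e, \<sigma>)\<close> lies strictly below the closed convex cone of penalised costs. A
  hyperplane separating them is the graph of a linear form up to translation, and this form is
  \<theta>.\<close>

lemma exists_linear_minorant:
  fixes B :: "('a::euclidean_space \<times> real) set"
  assumes zero: "(0, 0) \<in> B" and add: "\<And>x y. x \<in> B \<Longrightarrow> y \<in> B \<Longrightarrow> x + y \<in> B"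
    and C: "0 \<le> C"
    and lower: "\<And>L g N. (L, g) \<in> B \<Longrightarrow> 1 \<le> N \<Longrightarrow> \<rho> * real N \<le> g + C * norm (real N *\<^sub>R e - L)"
    and \<sigma>: "\<sigma> < \<rho>"
  shows "\<exists>\<theta>. (\<forall>(L, g)\<in>B. \<theta> \<bullet> L \<le> g) \<and> \<sigma> < \<theta> \<bullet> e"
proof -
  \<comment> \<open>\<open>A\<close> lies above the infimal convolution of the costs in
    \<open>B\<close> with \<open>C * norm\<close>, and \<open>E\<close> is its rational
    cone.\<close>
  define A where "A = {(v, r). \<exists>(L, g)\<in>B. g + C * norm (v - L) \<le> r}"
  define E where "E = {x. \<exists>m::nat. 1 \<le> m \<and> real m *\<^sub>R x \<in> A}"
  have A_add: "x + y \<in> A" if xy: "x \<in> A" "y \<in> A" for x y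
  proof -
    obtain v r w s L g L' g' where *: "x = (v, r)" "y = (w, s)" "(L, g) \<in> B" "(L', g') \<in> B"
      "g + C * norm (v - L) \<le> r" "g' + C * norm (w - L') \<le> s"
      using xy by (auto simp: A_def)
    have "norm ((v + w) - (L + L')) \<le> norm (v - L) + norm (w - L')"
      using norm_triangle_ineq[of "v - L" "w - L'"] by (simp add: algebra_simps)
    then have "C * norm ((v + w) - (L + L')) \<le> C * (norm (v - L) + norm (w - L'))"
      using C by (rule mult_left_mono)
    then have "(g + g') + C * norm ((v + w) - (L + L')) \<le> r + s"
      using * by (simp add: algebra_simps)
    moreover have "(L + L', g + g') \<in> B" using add[OF *(3,4)] by simp
    ultimately show ?thesis using * by (auto simp: A_def)
  qed
  have B_A: "(L, g) \<in> A" if "(L, g) \<in> B" for L g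
    using that by (force simp: A_def)
  have v_A: "(v, C * norm v) \<in> A" for v
    using zero by (force simp: A_def)
  have A_E: "x \<in> E" if "x \<in> A" for x
    using that by (auto simp: E_def intro!: exI[of _ 1])
  have conv: "convex (closure E)"
    unfolding E_def by (rule convex_closure_divisible_hull) (use A_add B_A[OF zero] in \<open>auto simp: zero_prod_def\<close>)
  \<comment> \<open>The triangle inequality moves \<open>lower\<close> from multiples of
    \<open>e\<close> to all points of \<open>E\<close>. With the slack
    \<open>C * norm (e - fst x)\<close> the bound is a closed condition, so it survives the closure,
    and it fails at \<open>(e, \<sigma>)\<close>.\<close>
  have "E \<subseteq> {x. \<rho> \<le> snd x + C * norm (e - fst x)}"
  proof
    fix x assume "x \<in> E"
    then obtain m :: nat and L g where m: "1 \<le> m" "(L, g) \<in> B"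
        "g + C * norm (real m *\<^sub>R fst x - L) \<le> real m * snd x"
      by (cases x) (auto simp: E_def A_def)
    have "\<rho> * real m \<le> g + C * norm (real m *\<^sub>R e - L)"
      using m by (intro lower)
    also have "norm (real m *\<^sub>R e - L) \<le> norm (real m *\<^sub>R fst x - L) + norm (real m *\<^sub>R (e - fst x))"
      using norm_triangle_ineq[of "real m *\<^sub>R fst x - L" "real m *\<^sub>R (e - fst x)"]
      by (simp add: algebra_simps)
    also have "norm (real m *\<^sub>R (e - fst x)) = real m * norm (e - fst x)" by simp
    finally have "\<rho> * real m \<le> g + C * (norm (real m *\<^sub>R fst x - L) + real m * norm (e - fst x))"
      using C by (auto intro: mult_left_mono)
    also have "\<dots> \<le> (snd x + C * norm (e - fst x)) * real m"
      using m by (simp add: algebra_simps)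
    finally show "x \<in> {x. \<rho> \<le> snd x + C * norm (e - fst x)}"
      using m by simp
  qed
  moreover have "closed {x :: 'a \<times> real. \<rho> \<le> snd x + C * norm (e - fst x)}"
    by (intro closed_Collect_le continuous_intros)
  ultimately have "closure E \<subseteq> {x. \<rho> \<le> snd x + C * norm (e - fst x)}"
    by (rule closure_minimal)
  then have "(e, \<sigma>) \<notin> closure E"
    using \<sigma> by auto
  then obtain a b where ab: "a \<bullet> (e, \<sigma>) < b" "\<And>x. x \<in> closure E \<Longrightarrow> b < a \<bullet> x"
    using separating_hyperplane_closed_point[OF conv closed_closure] by blast
  obtain h \<tau> where a: "a = (h, \<tau>)" by (cases a)
  have b: "b < h \<bullet> v + \<tau> * r" if "(v, r) \<in> A" for v r
    using ab(2)[of "(v, r)"] A_E[OF that] closure_subset[of E] by (auto simp: a)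
  \<comment> \<open>A functional bounded below on a semigroup is nonnegative there: multiples of a
    negative value would fall below \<open>b\<close>.\<close>
  have scaled: "0 \<le> h \<bullet> v + \<tau> * r" if vr: "(v, r) \<in> A" for v r
  proof (rule ccontr)
    assume neg: "\<not> ?thesis"
    have A_mult: "real n *\<^sub>R x \<in> A" if "x \<in> A" for n x
      using that B_A[OF zero]
      by (induction n) (auto simp: algebra_simps zero_prod_def intro: A_add)
    obtain n :: nat where n: "- b / - (h \<bullet> v + \<tau> * r) < real n"
      using reals_Archimedean2 by blast
    then have "real n * (h \<bullet> v + \<tau> * r) < b"
      using neg by (simp add: field_simps)
    moreover have "b < h \<bullet> (real n *\<^sub>R v) + \<tau> * (real n * r)"
      using b[of "real n *\<^sub>R v" "real n * r"] A_mult[OF vr, of n] by simp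
    ultimately show False by (simp add: algebra_simps)
  qed
  have "b < 0" using b[OF B_A[OF zero]] by simp
  have "(0, 1) \<in> A" using zero by (force simp: A_def)
  then have "0 \<le> \<tau>" using scaled by fastforce
  \<comment> \<open>A vertical hyperplane is impossible because \<open>A\<close> has the point
    \<open>(v, C * norm v)\<close> above every \<open>v\<close>; \<open>v = - h\<close> exhibits the
    conflict.\<close>
  moreover have "\<tau> \<noteq> 0"
  proof
    assume "\<tau> = 0"
    then have "h \<bullet> h \<le> 0" using scaled[OF v_A[of "- h"]] by simp
    then have "h = 0" by (meson inner_eq_zero_iff inner_ge_zero order_antisym)
    then show False using ab(1) \<open>\<tau> = 0\<close> \<open>b < 0\<close> by (simp add: a)
  qed
  ultimately have \<tau>: "0 < \<tau>" by simp
  define \<theta> where "\<theta> = (- 1 / \<tau>) *\<^sub>R h"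
  have "\<theta> \<bullet> L \<le> g" if "(L, g) \<in> B" for L g
    using scaled[OF B_A[OF that]] \<tau> by (simp add: \<theta>_def field_simps)
  moreover have "\<sigma> < \<theta> \<bullet> e"
  proof -
    have "\<tau> * \<sigma> < - (h \<bullet> e)" using ab(1) \<open>b < 0\<close> by (simp add: a)
    then show ?thesis using \<tau> by (simp add: \<theta>_def field_simps)
  qed
  ultimately show ?thesis by auto
qed

section \<open>Paths of the multidimensional QBD process\<close>

lemma qbd_stochastic: "qbd_matrix P \<Longrightarrow> stochastic_mat P"
  by (simp add: qbd_matrix_def)

lemma qbd_nonneg: "qbd_matrix P \<Longrightarrow> 0 \<le> P y y'"
  by (cases y; cases y') (simp add: qbd_matrix_def stochastic_mat_def)

lemma face_support: "x \<in> face {i. 0 < x i}"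
  by (simp add: face_def)

text \<open>Homogeneity of the process. Every point lies in the face of its support, so equal zero
  patterns and equal increments select the same block \<open>A\<close>. All translation arguments
  rest on this.\<close>

lemma qbd_shift:
  assumes "qbd_matrix P"
    and "\<And>i. int (y' i) - int (y i) = int (x' i) - int (x i)"
    and "\<And>i. x i = 0 \<longleftrightarrow> y i = 0" "\<And>i. x' i = 0 \<longleftrightarrow> y' i = 0"
  shows "P (x, j) (x', j') = P (y, j) (y', j')"
proof -
  have f: "x \<in> face {i. 0 < x i}" "y \<in> face {i. 0 < x i}" "x' \<in> face {i. 0 < x' i}" "y' \<in> face {i. 0 < x' i}"
    using assms(3,4) by (simp_all add: face_def neq0_conv[symmetric] del: neq0_conv)
  obtain A :: "'a set \<Rightarrow> 'a set \<Rightarrow> ('a \<Rightarrow> int) \<Rightarrow> real ^ 'b ^ 'b" where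
    A: "\<forall>\<alpha> \<beta>. \<forall>x\<in>face \<alpha>. \<forall>x'\<in>face \<beta>. \<forall>j j'.
           let l = (\<lambda>i. int (x' i) - int (x i)) in
           P (x, j) (x', j') =
             (if (\<forall>i\<in>\<alpha>. l i \<in> {-1, 0, 1}) \<and> (\<forall>i\<in>-\<alpha>. l i \<in> {0, 1})
              then A \<alpha> \<beta> l $ j $ j' else 0)"
    using assms(1) by (auto simp: qbd_matrix_def)
  show ?thesis
    using A[rule_format, OF f(1,3), of j j'] A[rule_format, OF f(2,4), of j j']
    by (simp only: Let_def assms(2))
qed

lemma qbd_range:
  assumes "qbd_matrix P" "0 < P (x, j) (x', j')"
  shows "\<bar>int (x' i) - int (x i)\<bar> \<le> 1"
proof -
  obtain A :: "'a set \<Rightarrow> 'a set \<Rightarrow> ('a \<Rightarrow> int) \<Rightarrow> real ^ 'b ^ 'b" where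
    A: "\<forall>\<alpha> \<beta>. \<forall>x\<in>face \<alpha>. \<forall>x'\<in>face \<beta>. \<forall>j j'.
           let l = (\<lambda>i. int (x' i) - int (x i)) in
           P (x, j) (x', j') =
             (if (\<forall>i\<in>\<alpha>. l i \<in> {-1, 0, 1}) \<and> (\<forall>i\<in>-\<alpha>. l i \<in> {0, 1})
              then A \<alpha> \<beta> l $ j $ j' else 0)"
    using assms(1) by (auto simp: qbd_matrix_def)
  have l: "(\<forall>i\<in>{i. 0 < x i}. int (x' i) - int (x i) \<in> {-1, 0, 1}) \<and>
      (\<forall>i\<in>- {i. 0 < x i}. int (x' i) - int (x i) \<in> {0, 1})"
    using A[rule_format, OF face_support[of x] face_support[of x'], of j j'] assms(2)
    by (auto simp: Let_def split: if_splits)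
  have "int (x' i) - int (x i) \<in> {-1, 0, 1}"
  proof (cases "0 < x i")
    case True
    then have "i \<in> {i. 0 < x i}" by simp
    with l show ?thesis by blast
  next
    case False
    then have "i \<in> - {i. 0 < x i}" by simp
    with l have "int (x' i) - int (x i) \<in> {0, 1}" by blast
    then show ?thesis by blast
  qed
  then show ?thesis by auto
qed

text \<open>The height 2 in \<open>P_star\<close> is only a representative: from any height at least
  2 a step down still ends above 0, so source and target keep their zero patterns.\<close>

lemma P_star_shift:
  assumes P: "qbd_matrix P" and z: "\<And>i. i \<in> \<alpha> \<Longrightarrow> 2 \<le> z i"
  shows "P_star P \<alpha> \<theta> (u, j) (u', j') =
     (\<Sum>l\<in>\<alpha> \<rightarrow>\<^sub>E {-1, 0, 1::int}.
       exp (\<Sum>i\<in>\<alpha>. of_int (l i) * \<theta> $ i) *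
       P (override_on u z \<alpha>, j) (override_on u' (\<lambda>i. nat (int (z i) + l i)) \<alpha>, j'))"
proof -
  have "P (override_on u (\<lambda>i. 2) \<alpha>, j) (override_on u' (\<lambda>i. nat (2 + l i)) \<alpha>, j') =
      P (override_on u z \<alpha>, j) (override_on u' (\<lambda>i. nat (int (z i) + l i)) \<alpha>, j')"
    if l: "l \<in> \<alpha> \<rightarrow>\<^sub>E {-1, 0, 1}" for l
  proof (rule qbd_shift[OF P])
    have *: "l i = -1 \<or> l i = 0 \<or> l i = 1" if "i \<in> \<alpha>" for i
      using PiE_mem[OF l that] by auto
    fix i
    show "int (override_on u' (\<lambda>i. nat (int (z i) + l i)) \<alpha> i) - int (override_on u z \<alpha> i) =
        int (override_on u' (\<lambda>i. nat (2 + l i)) \<alpha> i) - int (override_on u (\<lambda>i. 2) \<alpha> i)"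
      using *[of i] z[of i] by (cases "i \<in> \<alpha>") (auto simp: override_on_def)
    show "(override_on u (\<lambda>i. 2) \<alpha> i = 0) = (override_on u z \<alpha> i = 0)"
      using z[of i] by (cases "i \<in> \<alpha>") (auto simp: override_on_def)
    show "(override_on u' (\<lambda>i. nat (2 + l i)) \<alpha> i = 0) =
        (override_on u' (\<lambda>i. nat (int (z i) + l i)) \<alpha> i = 0)"
      using *[of i] z[of i] by (cases "i \<in> \<alpha>") (auto simp: override_on_def)
  qed
  then show ?thesis by (auto simp: P_star_def intro!: sum.cong)
qed

text \<open>The exponential weights are positive, so the support of \<open>P_star\<close> is the
  same for every \<theta>. This carries irreducibility from \<theta> = 0 to all \<theta>.\<close>

lemma P_star_pos_iff:
  assumes "qbd_matrix P"
  shows "0 < P_star P \<alpha> \<theta> (u, j) (u', j') \<longleftrightarrow>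
    (\<exists>l\<in>\<alpha> \<rightarrow>\<^sub>E {-1, 0, 1::int}.
       0 < P (override_on u (\<lambda>i. 2) \<alpha>, j) (override_on u' (\<lambda>i. nat (2 + l i)) \<alpha>, j'))"
proof -
  have fin: "finite (\<alpha> \<rightarrow>\<^sub>E {-1, 0, 1::int})" by (intro finite_PiE) auto
  have nn: "0 \<le> exp (\<Sum>i\<in>\<alpha>. of_int (l i) * \<theta> $ i) *
       P (override_on u (\<lambda>i. 2) \<alpha>, j) (override_on u' (\<lambda>i. nat (2 + l i)) \<alpha>, j')" for l
    using qbd_nonneg[OF assms] by simp
  show ?thesis
    unfolding P_star_def
    using sum_nonneg_eq_0_iff[OF fin nn] sum_nonneg[of "\<alpha> \<rightarrow>\<^sub>E {-1, 0, 1::int}", OF nn]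
      qbd_nonneg[OF assms]
    by (auto simp: less_le)
qed

text \<open>The jump \<open>l\<close> is picked from the finite sum in \<open>P_star\<close>. All
  translates of the step have one common probability, which later makes the cost of a path
  independent of the starting height.\<close>

lemma Q_star_posD:
  assumes P: "qbd_matrix P" and pos: "0 < Q_star P \<alpha> k \<theta> (m, u, j) (m', u', j')" and k: "k \<notin> \<alpha>"
  obtains l where "\<bar>int m' - int m\<bar> \<le> 1" "\<And>i. i \<in> \<alpha> \<Longrightarrow> \<bar>l i\<bar> \<le> 1" "l \<in> \<alpha> \<rightarrow>\<^sub>E {-1, 0, 1::int}"
    "\<And>z z' t. (\<And>i. i \<in> \<alpha> \<Longrightarrow> 2 \<le> z i \<and> int (z' i) = int (z i) + l i) \<Longrightarrow>
       (\<And>i. i \<notin> \<alpha> \<Longrightarrow> i \<noteq> k \<Longrightarrow> z i = u i \<and> z' i = u' i) \<Longrightarrow>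
       z k = m + t + 1 \<Longrightarrow> z' k = m' + t + 1 \<Longrightarrow>
       P (z, j) (z', j') = P (override_on (u(k := 2)) (\<lambda>i. 2) \<alpha>, j)
         (override_on (u'(k := nat (2 + (int m' - int m)))) (\<lambda>i. nat (2 + l i)) \<alpha>, j')"
    "0 < P (override_on (u(k := 2)) (\<lambda>i. 2) \<alpha>, j)
         (override_on (u'(k := nat (2 + (int m' - int m)))) (\<lambda>i. nat (2 + l i)) \<alpha>, j')"
proof -
  have m: "\<bar>int m' - int m\<bar> \<le> 1"
    and ps: "0 < P_star P \<alpha> \<theta> (u(k := 2), j) (u'(k := nat (2 + (int m' - int m))), j')"
    using pos by (auto simp: Q_star_def block_tridiag_def level_block_def split: if_splits)
  obtain l where l: "l \<in> \<alpha> \<rightarrow>\<^sub>E {-1, 0, 1}"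
    and p: "0 < P (override_on (u(k := 2)) (\<lambda>i. 2) \<alpha>, j)
         (override_on (u'(k := nat (2 + (int m' - int m)))) (\<lambda>i. nat (2 + l i)) \<alpha>, j')"
    using ps[unfolded P_star_pos_iff[OF P]] by (rule bexE)
  have *: "\<bar>l i\<bar> \<le> 1" if "i \<in> \<alpha>" for i
    using PiE_mem[OF l that] by auto
  show ?thesis
  proof (rule that[of l])
    show "\<bar>int m' - int m\<bar> \<le> 1" by (rule m)
    show "\<bar>l i\<bar> \<le> 1" if "i \<in> \<alpha>" for i using that by (rule *)
    show "l \<in> \<alpha> \<rightarrow>\<^sub>E {-1, 0, 1}" by (rule l)
    show "0 < P (override_on (u(k := 2)) (\<lambda>i. 2) \<alpha>, j)
         (override_on (u'(k := nat (2 + (int m' - int m)))) (\<lambda>i. nat (2 + l i)) \<alpha>, j')" by (rule p)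
    fix z z' :: "'a \<Rightarrow> nat" and t
    assume z: "\<And>i. i \<in> \<alpha> \<Longrightarrow> 2 \<le> z i \<and> int (z' i) = int (z i) + l i"
      "\<And>i. i \<notin> \<alpha> \<Longrightarrow> i \<noteq> k \<Longrightarrow> z i = u i \<and> z' i = u' i"
      "z k = m + t + 1" "z' k = m' + t + 1"
    show "P (z, j) (z', j') = P (override_on (u(k := 2)) (\<lambda>i. 2) \<alpha>, j)
         (override_on (u'(k := nat (2 + (int m' - int m)))) (\<lambda>i. nat (2 + l i)) \<alpha>, j')"
    proof (rule qbd_shift[OF P])
      fix i
      show "int (override_on (u'(k := nat (2 + (int m' - int m)))) (\<lambda>i. nat (2 + l i)) \<alpha> i)
          - int (override_on (u(k := 2)) (\<lambda>i. 2) \<alpha> i) = int (z' i) - int (z i)"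
        using z m *[of i] k by (cases "i \<in> \<alpha>"; cases "i = k") (auto simp: override_on_def)
      show "(z i = 0) = (override_on (u(k := 2)) (\<lambda>i. 2) \<alpha> i = 0)"
        using z(1)[of i] z(2)[of i] z(3) k by (cases "i \<in> \<alpha>"; cases "i = k") (auto simp: override_on_def)
      show "(z' i = 0) = (override_on (u'(k := nat (2 + (int m' - int m)))) (\<lambda>i. nat (2 + l i)) \<alpha> i = 0)"
        using z(1)[of i] z(2)[of i] z(4) m *[of i] k by (cases "i \<in> \<alpha>"; cases "i = k") (auto simp: override_on_def)
    qed
  qed
qed

text \<open>
  Level \<open>m\<close> of $Q^{\alpha,\{k\}}_*$ stands for $x(k) = m + 1$, because its level 0 has no
  boundary transitions; the path may moreover be shifted up by any \<open>t\<close>.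
\<close>

lemma Q_star_path_cost:
  assumes P: "qbd_matrix P" and k: "k \<notin> \<alpha>"
    and "0 < mat_pow I (Q_star P \<alpha> k \<theta>) n (m, u, j) (m', u', j')"
  shows "\<exists>c l. (\<forall>i\<in>\<alpha>. \<bar>l i\<bar> \<le> int n) \<and>
    (\<forall>z z' t. (\<forall>i\<in>\<alpha>. n + 1 \<le> z i \<and> int (z' i) = int (z i) + l i) \<longrightarrow>
       (\<forall>i. i \<notin> \<alpha> \<longrightarrow> i \<noteq> k \<longrightarrow> z i = u i \<and> z' i = u' i) \<longrightarrow>
       z k = m + t + 1 \<longrightarrow> z' k = m' + t + 1 \<longrightarrow> cost_le P c (z, j) (z', j'))"
  using assms(3)
proof (induction n arbitrary: m u j)
  case 0
  then have eq: "m' = m" "u' = u" "j' = j" by (auto split: if_splits)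
  have "cost_le P 0 (z, j) (z', j)"
    if "\<forall>i\<in>\<alpha>. int (z' i) = int (z i)" "\<forall>i. i \<notin> \<alpha> \<longrightarrow> i \<noteq> k \<longrightarrow> z i = u i \<and> z' i = u i"
       "z k = z' k" for z z'
  proof -
    have "z = z'"
    proof
      fix i show "z i = z' i"
        using that by (cases "i \<in> \<alpha>"; cases "i = k") auto
    qed
    then show ?thesis by (simp add: cost_le_refl)
  qed
  then show ?case
    using eq by (intro exI[of _ 0] exI[of _ "\<lambda>_. 0"]) auto
next
  case (Suc n)
  obtain m1 u1 j1 where h: "0 < Q_star P \<alpha> k \<theta> (m, u, j) (m1, u1, j1)"
      "0 < mat_pow I (Q_star P \<alpha> k \<theta>) n (m1, u1, j1) (m', u', j')"
    by (rule mat_pow_Suc_posE[OF Suc.prems]) (metis prod_cases3)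
  obtain c l where cl: "\<forall>i\<in>\<alpha>. \<bar>l i\<bar> \<le> int n"
    "\<And>z z' t. (\<forall>i\<in>\<alpha>. n + 1 \<le> z i \<and> int (z' i) = int (z i) + l i) \<Longrightarrow>
       (\<forall>i. i \<notin> \<alpha> \<longrightarrow> i \<noteq> k \<longrightarrow> z i = u1 i \<and> z' i = u' i) \<Longrightarrow>
       z k = m1 + t + 1 \<Longrightarrow> z' k = m' + t + 1 \<Longrightarrow> cost_le P c (z, j1) (z', j')"
    using Suc.IH[OF h(2)] by blast
  \<comment> \<open>\<open>p l0\<close> is fixed before \<open>z\<close>, \<open>z'\<close> and
    \<open>t\<close>; it is the probability of the first step at every admissible translate.\<close>
  define p where "p l0 = P (override_on (u(k := 2)) (\<lambda>i. 2) \<alpha>, j)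
      (override_on (u1(k := nat (2 + (int m1 - int m)))) (\<lambda>i. nat (2 + l0 i)) \<alpha>, j1)" for l0 :: "'a \<Rightarrow> int"
  obtain l0 where l0: "\<And>i. i \<in> \<alpha> \<Longrightarrow> \<bar>l0 i\<bar> \<le> 1"
    "\<And>z z' t. (\<And>i. i \<in> \<alpha> \<Longrightarrow> 2 \<le> z i \<and> int (z' i) = int (z i) + l0 i) \<Longrightarrow>
       (\<And>i. i \<notin> \<alpha> \<Longrightarrow> i \<noteq> k \<Longrightarrow> z i = u i \<and> z' i = u1 i) \<Longrightarrow>
       z k = m + t + 1 \<Longrightarrow> z' k = m1 + t + 1 \<Longrightarrow> P (z, j) (z', j1) = p l0"
    "0 < p l0"
    unfolding p_def by (rule Q_star_posD[OF P h(1) k]) blast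
  have "cost_le P (- ln (p l0) + c) (z, j) (z', j')"
    if z: "\<And>i. i \<in> \<alpha> \<Longrightarrow> Suc n + 1 \<le> z i \<and> int (z' i) = int (z i) + (l0 i + l i)"
       "\<And>i. i \<notin> \<alpha> \<Longrightarrow> i \<noteq> k \<Longrightarrow> z i = u i \<and> z' i = u' i"
       "z k = m + t + 1" "z' k = m' + t + 1" for z z' t
  proof -
    \<comment> \<open>The state after the first step: it has lost at most 1 of the height
      \<open>Suc n + 1\<close> in each direction of \<alpha>, which leaves the \<open>n + 1\<close>
      required for the rest.\<close>
    define z1 where "z1 i = (if i \<in> \<alpha> then nat (int (z i) + l0 i) else if i = k then m1 + t + 1 else u1 i)" for i
    have z1: "int (z1 i) = int (z i) + l0 i" if "i \<in> \<alpha>" for i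
      using z(1)[OF that] l0(1)[OF that] that by (auto simp: z1_def)
    have "P (z, j) (z1, j1) = p l0"
    proof (rule l0(2))
      show "2 \<le> z i \<and> int (z1 i) = int (z i) + l0 i" if "i \<in> \<alpha>" for i
        using z(1)[OF that] z1[OF that] by linarith
    qed (use z k in \<open>auto simp: z1_def\<close>)
    then have "cost_le P (- ln (p l0)) (z, j) (z1, j1)"
      using l0(3) by (intro cost_le_step) auto
    moreover have "cost_le P c (z1, j1) (z', j')"
    proof (rule cl(2))
      show "\<forall>i\<in>\<alpha>. n + 1 \<le> z1 i \<and> int (z' i) = int (z1 i) + l i"
      proof
        fix i assume i: "i \<in> \<alpha>"
        show "n + 1 \<le> z1 i \<and> int (z' i) = int (z1 i) + l i"
          using z(1)[OF i] z1[OF i] l0(1)[OF i] by linarith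
      qed
    qed (use z k in \<open>auto simp: z1_def\<close>)
    ultimately show ?thesis by (rule cost_le_trans)
  qed
  moreover have "\<forall>i\<in>\<alpha>. \<bar>l0 i + l i\<bar> \<le> int (Suc n)"
    using cl(1) l0(1) by fastforce
  ultimately show ?case
    by (intro exI[of _ "- ln (p l0) + c"] exI[of _ "\<lambda>i. l0 i + l i"] conjI allI impI) simp_all
qed

section \<open>Membership in Gamma bar\<close>

text \<open>From height \<open>n + 1\<close> a path of \<open>n\<close> steps stays positive in the
  directions of \<beta>, so translating it by \<open>y - z\<close> preserves all its transition
  probabilities, and distinct paths stay distinct.\<close>

lemma mat_pow_shift_le:
  assumes P: "qbd_matrix P"
    and "\<And>i. i \<in> \<beta> \<Longrightarrow> n + 1 \<le> z i \<and> n + 1 \<le> y i"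
    and "\<And>i. i \<notin> \<beta> \<Longrightarrow> y i = z i"
    and "\<And>i. int (y' i) - int (y i) = int (z' i) - int (z i)"
  shows "mat_pow UNIV P n (z, j) (z', j') \<le> mat_pow UNIV P n (y, j) (y', j')"
  using assms(2-)
proof (induction n arbitrary: z y j)
  case 0
  have "y = y'" if "z = z'"
  proof
    fix i show "y i = y' i" using 0(3)[of i] that by simp
  qed
  then show ?case by auto
next
  case (Suc n)
  define \<phi> :: "('a \<Rightarrow> nat) \<times> 'b \<Rightarrow> ('a \<Rightarrow> nat) \<times> 'b" where
    "\<phi> = (\<lambda>(w, i). (\<lambda>a. nat (int (w a) + int (y a) - int (z a)), i))"
  \<comment> \<open>Successors of positive probability differ from \<open>z\<close> by at most 1, so
    on \<open>S\<close> the truncation in \<phi> never acts and \<phi> is an injective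
    translation.\<close>
  define S where "S = {h. 0 < P (z, j) h}"
  have S: "\<bar>int (w a) - int (z a)\<bar> \<le> 1" "int (fst (\<phi> (w, i)) a) = int (w a) + int (y a) - int (z a)"
    if "(w, i) \<in> S" for w i a
  proof -
    show *: "\<bar>int (w a) - int (z a)\<bar> \<le> 1"
      using that qbd_range[OF P] by (simp add: S_def)
    show "int (fst (\<phi> (w, i)) a) = int (w a) + int (y a) - int (z a)"
      using * Suc.prems(1)[of a] Suc.prems(2)[of a] by (cases "a \<in> \<beta>") (auto simp: \<phi>_def)
  qed
  have inj: "inj_on \<phi> S"
  proof (rule inj_onI)
    fix h h' assume h: "h \<in> S" "h' \<in> S" "\<phi> h = \<phi> h'"
    obtain w i w' i' where [simp]: "h = (w, i)" "h' = (w', i')" by (cases h; cases h')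
    have "w a = w' a" for a
      using S(2)[of w i a] S(2)[of w' i' a] h by simp
    moreover have "i = i'" using h(3) by (simp add: \<phi>_def)
    ultimately show "h = h'" by auto
  qed
  have bound: "ennreal (P (z, j) h) * mat_pow UNIV P n h (z', j')
      \<le> ennreal (P (y, j) (\<phi> h)) * mat_pow UNIV P n (\<phi> h) (y', j')" if h: "h \<in> S" for h
  proof -
    obtain w i where [simp]: "h = (w, i)" by (cases h)
    define w' where "w' = fst (\<phi> h)"
    have \<phi>: "\<phi> h = (w', i)" by (simp add: w'_def \<phi>_def)
    have w: "\<bar>int (w a) - int (z a)\<bar> \<le> 1" "int (w' a) = int (w a) + int (y a) - int (z a)" for a
      using S[of w i a] h by (auto simp: w'_def)
    have "P (z, j) (w, i) = P (y, j) (w', i)"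
    proof (rule qbd_shift[OF P])
      fix a
      show "int (w' a) - int (y a) = int (w a) - int (z a)" using w(2)[of a] by simp
      show "(z a = 0) = (y a = 0)"
        using Suc.prems(1)[of a] Suc.prems(2)[of a] by (cases "a \<in> \<beta>") auto
      show "(w a = 0) = (w' a = 0)"
        using Suc.prems(1)[of a] Suc.prems(2)[of a] w[of a] by (cases "a \<in> \<beta>") auto
    qed
    moreover have "mat_pow UNIV P n (w, i) (z', j') \<le> mat_pow UNIV P n (w', i) (y', j')"
    proof (rule Suc.IH)
      fix a
      show "n + 1 \<le> w a \<and> n + 1 \<le> w' a" if "a \<in> \<beta>"
        using Suc.prems(1)[OF that] w[of a] by linarith
      show "w' a = w a" if "a \<notin> \<beta>"
        using Suc.prems(2)[OF that] w[of a] by simp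
      show "int (y' a) - int (w' a) = int (z' a) - int (w a)"
        using Suc.prems(3)[of a] w[of a] by simp
    qed
    ultimately show ?thesis unfolding \<phi> by (simp add: mult_left_mono)
  qed
  have "(\<Sum>h\<in>F. ennreal (P (z, j) h) * mat_pow UNIV P n h (z', j')) \<le> mat_pow UNIV P (Suc n) (y, j) (y', j')"
    if F: "finite F" for F
  proof -
    have "(\<Sum>h\<in>F. ennreal (P (z, j) h) * mat_pow UNIV P n h (z', j')) =
        (\<Sum>h\<in>F \<inter> S. ennreal (P (z, j) h) * mat_pow UNIV P n h (z', j'))"
      using F qbd_nonneg[OF P] by (intro sum.mono_neutral_right) (auto simp: S_def not_less ennreal_neg)
    also have "\<dots> \<le> (\<Sum>h\<in>F \<inter> S. ennreal (P (y, j) (\<phi> h)) * mat_pow UNIV P n (\<phi> h) (y', j'))"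
      using bound by (intro sum_mono) auto
    also have "\<dots> = (\<Sum>h\<in>\<phi> ` (F \<inter> S). ennreal (P (y, j) h) * mat_pow UNIV P n h (y', j'))"
      using inj by (subst sum.reindex) (auto intro: inj_on_subset)
    also have "\<dots> \<le> (\<Sum>\<^sub>\<infinity>h. ennreal (P (y, j) h) * mat_pow UNIV P n h (y', j'))"
      using F by (intro sum_le_infsum_ennreal) auto
    finally show ?thesis by simp
  qed
  then show ?case
    unfolding mat_pow.simps(2)[of UNIV P n] by (intro infsum_ennreal_le)
qed

abbreviation nat_box :: "'d set \<Rightarrow> ('d \<Rightarrow> nat) \<Rightarrow> nat \<Rightarrow> ('d \<Rightarrow> nat) set" where
  "nat_box \<beta> z n \<equiv> PiE \<beta> (\<lambda>i. {z i - n..z i + n})"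

text \<open>
  A power of $P^\beta_*(\theta(\beta))$ is an exponential sum of transition probabilities of the
  original chain, started too far from the boundary to notice it within \<open>n\<close> steps.
\<close>

lemma mat_pow_P_star_le:
  fixes P :: "('d::finite, 's::finite) state \<Rightarrow> ('d, 's) state \<Rightarrow> real"
  assumes P: "qbd_matrix P"
    and "\<And>i. i \<in> \<beta> \<Longrightarrow> n + 1 \<le> z i"
    and "(u, j) \<in> indices (- \<beta>)" and u': "(u', j') \<in> indices (- \<beta>)"
  shows "mat_pow (indices (- \<beta>)) (P_star P \<beta> \<theta>) n (u, j) (u', j') \<le>
    (\<Sum>w\<in>nat_box \<beta> z n. ennreal (exp (\<Sum>i\<in>\<beta>. (real (w i) - real (z i)) * \<theta> $ i)) *
       mat_pow UNIV P n (override_on u z \<beta>, j) (override_on u' w \<beta>, j'))"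
  using assms(2,3)
proof (induction n arbitrary: z u j)
  case 0
  show ?case
  proof (cases "(u, j) = (u', j')")
    case True
    have "1 = ennreal (exp (\<Sum>i\<in>\<beta>. (real (restrict z \<beta> i) - real (z i)) * \<theta> $ i)) *
       mat_pow UNIV P 0 (override_on u z \<beta>, j) (override_on u' (restrict z \<beta>) \<beta>, j')"
      using True by (auto simp: override_on_def)
    also have "\<dots> \<le> (\<Sum>w\<in>nat_box \<beta> z 0. ennreal (exp (\<Sum>i\<in>\<beta>. (real (w i) - real (z i)) * \<theta> $ i)) *
       mat_pow UNIV P 0 (override_on u z \<beta>, j) (override_on u' w \<beta>, j'))"
      by (rule member_le_sum) (auto intro!: finite_PiE)
    finally show ?thesis using True by simp
  qed auto
next
  case (Suc n)
  define L where "L = \<beta> \<rightarrow>\<^sub>E {-1, 0, 1::int}"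
  define zl where "zl l i = nat (int (z i) + l i)" for l :: "'d \<Rightarrow> int" and i
  \<comment> \<open>\<phi> merges an index of \<open>P_star\<close> and a jump \<open>l\<close> into
    a successor state of the original chain. It is injective, so the double sum over indices and
    jumps is part of the sum over all successors.\<close>
  define \<phi> where "\<phi> = (\<lambda>(h, l). (override_on (fst h) (zl l) \<beta>, snd h :: 's))"
  define e where "e w = ennreal (exp (\<Sum>i\<in>\<beta>. (real (w i) - real (z i)) * \<theta> $ i))" for w :: "'d \<Rightarrow> nat"
  define y where "y = (override_on u z \<beta>, j)"
  define y' where "y' w = (override_on u' w \<beta>, j')" for w
  define f where "f w g = ennreal (P y g) * mat_pow UNIV P n g (y' w)" for w g
  have finL: "finite L" unfolding L_def by (intro finite_PiE) auto
  have L: "\<bar>l i\<bar> \<le> 1" "int (zl l i) = int (z i) + l i" "n + 1 \<le> zl l i" if "l \<in> L" "i \<in> \<beta>" for l i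
  proof -
    have "l i \<in> {-1, 0, 1}" using that by (auto simp: L_def dest: PiE_mem)
    then show "\<bar>l i\<bar> \<le> 1" by auto
    with Suc.prems(1)[OF that(2)] show "int (zl l i) = int (z i) + l i" "n + 1 \<le> zl l i"
      by (auto simp: zl_def)
  qed
  have inj: "inj_on \<phi> (indices (- \<beta>) \<times> L)"
  proof (rule inj_onI)
    fix p q :: "('d, 's) state \<times> ('d \<Rightarrow> int)"
    assume pq: "p \<in> indices (- \<beta>) \<times> L" "q \<in> indices (- \<beta>) \<times> L" "\<phi> p = \<phi> q"
    obtain v i l v' i' l' where [simp]: "p = ((v, i), l)" "q = ((v', i'), l')"
      by (metis prod.exhaust)
    have l: "l \<in> L" "l' \<in> L" and v: "v \<in> - \<beta> \<rightarrow>\<^sub>E UNIV" "v' \<in> - \<beta> \<rightarrow>\<^sub>E UNIV"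
      using pq by (auto simp: indices_def)
    have o: "override_on v (zl l) \<beta> a = override_on v' (zl l') \<beta> a" for a
      using pq(3) by (auto simp: \<phi>_def dest: fun_cong)
    have "v = v'"
    proof (rule PiE_ext[OF v])
      fix a assume "a \<in> - \<beta>"
      then show "v a = v' a" using o[of a] by (simp add: override_on_def)
    qed
    moreover have "l = l'"
    proof (rule PiE_ext[OF l[unfolded L_def]])
      fix a assume "a \<in> \<beta>"
      then show "l a = l' a" using o[of a] L(2)[OF l(1), of a] L(2)[OF l(2), of a]
        by (simp add: override_on_def)
    qed
    ultimately show "p = q" using pq(3) by (simp add: \<phi>_def)
  qed
  have step: "ennreal (P_star P \<beta> \<theta> (u, j) h) * mat_pow (indices (- \<beta>)) (P_star P \<beta> \<theta>) n h (u', j')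
      \<le> (\<Sum>l\<in>L. \<Sum>w\<in>nat_box \<beta> z (Suc n). e w * f w (\<phi> (h, l)))" if h: "h \<in> indices (- \<beta>)" for h
  proof -
    obtain v i where [simp]: "h = (v, i)" by (cases h)
    define q where "q l = exp (\<Sum>i\<in>\<beta>. of_int (l i) * \<theta> $ i) * P y (\<phi> (h, l))" for l
    have "P_star P \<beta> \<theta> (u, j) h = (\<Sum>l\<in>L. q l)"
    proof -
      have "2 \<le> z a" if "a \<in> \<beta>" for a using Suc.prems(1)[OF that] by simp
      then show ?thesis
        by (simp add: P_star_shift[OF P, of \<beta> z] L_def q_def \<phi>_def y_def zl_def[abs_def])
    qed
    moreover have q0: "0 \<le> q l" for l using qbd_nonneg[OF P] by (simp add: q_def)
    ultimately have "ennreal (P_star P \<beta> \<theta> (u, j) h) = (\<Sum>l\<in>L. ennreal (q l))"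
      by (simp add: sum_ennreal)
    then have "ennreal (P_star P \<beta> \<theta> (u, j) h) * mat_pow (indices (- \<beta>)) (P_star P \<beta> \<theta>) n h (u', j') =
      (\<Sum>l\<in>L. ennreal (q l) * mat_pow (indices (- \<beta>)) (P_star P \<beta> \<theta>) n h (u', j'))"
      by (simp add: sum_distrib_right)
    also have "\<dots> \<le> (\<Sum>l\<in>L. \<Sum>w\<in>nat_box \<beta> z (Suc n). e w * f w (\<phi> (h, l)))"
    proof (rule sum_mono)
      fix l assume l: "l \<in> L"
      have "mat_pow (indices (- \<beta>)) (P_star P \<beta> \<theta>) n h (u', j') \<le>
          (\<Sum>w\<in>nat_box \<beta> (zl l) n. ennreal (exp (\<Sum>i\<in>\<beta>. (real (w i) - real (zl l i)) * \<theta> $ i)) *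
            mat_pow UNIV P n (\<phi> (h, l)) (y' w))"
        using Suc.IH[of "zl l" v i] L(3)[OF l] h by (simp add: \<phi>_def y'_def)
      then have "ennreal (q l) * mat_pow (indices (- \<beta>)) (P_star P \<beta> \<theta>) n h (u', j') \<le>
          ennreal (q l) * (\<Sum>w\<in>nat_box \<beta> (zl l) n. ennreal (exp (\<Sum>i\<in>\<beta>. (real (w i) - real (zl l i)) * \<theta> $ i)) *
            mat_pow UNIV P n (\<phi> (h, l)) (y' w))"
        by (rule mult_left_mono) simp
      also have "\<dots> = (\<Sum>w\<in>nat_box \<beta> (zl l) n. e w * f w (\<phi> (h, l)))"
        unfolding sum_distrib_left
      proof (rule sum.cong[OF refl])
        fix w
        \<comment> \<open>The exponents telescope: the first jump plus the displacement from the new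
          base point \<open>zl l\<close> is the displacement from \<open>z\<close>.\<close>
        have "(\<Sum>i\<in>\<beta>. real_of_int (l i) * \<theta> $ i) + (\<Sum>i\<in>\<beta>. (real (w i) - real (zl l i)) * \<theta> $ i)
            = (\<Sum>i\<in>\<beta>. (real (w i) - real (z i)) * \<theta> $ i)"
          unfolding sum.distrib[symmetric]
        proof (rule sum.cong[OF refl])
          fix a assume "a \<in> \<beta>"
          then have "real (zl l a) = real (z a) + real_of_int (l a)"
            using L(2)[OF l, of a] by (metis of_int_add of_int_of_nat_eq)
          then show "real_of_int (l a) * \<theta> $ a + (real (w a) - real (zl l a)) * \<theta> $ a =
              (real (w a) - real (z a)) * \<theta> $ a"
            by (simp add: algebra_simps)
        qed
        then have "q l * exp (\<Sum>i\<in>\<beta>. (real (w i) - real (zl l i)) * \<theta> $ i) =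
            exp (\<Sum>i\<in>\<beta>. (real (w i) - real (z i)) * \<theta> $ i) * P y (\<phi> (h, l))"
          by (simp add: q_def exp_add[symmetric] mult.commute mult.left_commute)
        then have "ennreal (q l) * ennreal (exp (\<Sum>i\<in>\<beta>. (real (w i) - real (zl l i)) * \<theta> $ i)) =
            e w * ennreal (P y (\<phi> (h, l)))"
          using qbd_nonneg[OF P] q0 by (simp add: e_def ennreal_mult[symmetric])
        then show "ennreal (q l) * (ennreal (exp (\<Sum>i\<in>\<beta>. (real (w i) - real (zl l i)) * \<theta> $ i)) *
            mat_pow UNIV P n (\<phi> (h, l)) (y' w)) = e w * f w (\<phi> (h, l))"
          by (simp add: f_def mult.assoc[symmetric])
      qed
      also have "\<dots> \<le> (\<Sum>w\<in>nat_box \<beta> z (Suc n). e w * f w (\<phi> (h, l)))"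
      proof (rule sum_mono2)
        show "finite (nat_box \<beta> z (Suc n))" by (intro finite_PiE) auto
        show "nat_box \<beta> (zl l) n \<subseteq> nat_box \<beta> z (Suc n)"
        proof (rule PiE_mono)
          fix a assume "a \<in> \<beta>"
          then show "{zl l a - n..zl l a + n} \<subseteq> {z a - Suc n..z a + Suc n}"
            using L[OF l, of a] by auto
        qed
      qed simp
      finally show "ennreal (q l) * mat_pow (indices (- \<beta>)) (P_star P \<beta> \<theta>) n h (u', j')
          \<le> (\<Sum>w\<in>nat_box \<beta> z (Suc n). e w * f w (\<phi> (h, l)))" .
    qed
    finally show ?thesis .
  qed
  have "(\<Sum>h\<in>F. ennreal (P_star P \<beta> \<theta> (u, j) h) * mat_pow (indices (- \<beta>)) (P_star P \<beta> \<theta>) n h (u', j'))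
      \<le> (\<Sum>w\<in>nat_box \<beta> z (Suc n). e w * mat_pow UNIV P (Suc n) y (y' w))"
    if F: "finite F" "F \<subseteq> indices (- \<beta>)" for F
  proof -
    have "(\<Sum>h\<in>F. ennreal (P_star P \<beta> \<theta> (u, j) h) * mat_pow (indices (- \<beta>)) (P_star P \<beta> \<theta>) n h (u', j'))
      \<le> (\<Sum>h\<in>F. \<Sum>l\<in>L. \<Sum>w\<in>nat_box \<beta> z (Suc n). e w * f w (\<phi> (h, l)))"
      using F by (intro sum_mono step) auto
    also have "\<dots> = (\<Sum>p\<in>F \<times> L. \<Sum>w\<in>nat_box \<beta> z (Suc n). e w * f w (\<phi> p))"
      by (subst sum.cartesian_product) (simp add: case_prod_unfold)
    also have "\<dots> = (\<Sum>w\<in>nat_box \<beta> z (Suc n). e w * (\<Sum>p\<in>F \<times> L. f w (\<phi> p)))"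
      by (subst sum.swap) (simp add: sum_distrib_left)
    also have "\<dots> \<le> (\<Sum>w\<in>nat_box \<beta> z (Suc n). e w * mat_pow UNIV P (Suc n) y (y' w))"
    proof (intro sum_mono mult_left_mono)
      fix w
      have "(\<Sum>p\<in>F \<times> L. f w (\<phi> p)) = (\<Sum>g\<in>\<phi> ` (F \<times> L). f w g)"
        using inj F by (subst sum.reindex) (auto intro: inj_on_subset)
      also have "\<dots> \<le> mat_pow UNIV P (Suc n) y (y' w)"
        using F finL by (auto simp: f_def intro!: sum_le_infsum_ennreal)
      finally show "(\<Sum>p\<in>F \<times> L. f w (\<phi> p)) \<le> mat_pow UNIV P (Suc n) y (y' w)" .
    qed simp
    finally show ?thesis .
  qed
  then show ?case
    unfolding mat_pow.simps(2)[of "indices (- \<beta>)"] e_def y_def y'_def by (intro infsum_ennreal_le)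
qed

text \<open>With y the (m+1)-st root of z, each of the m linear factors absorbs one factor y^n and
  stays bounded; the last y^n gives a geometric majorant.\<close>

lemma summable_polynomial_geometric:
  fixes z :: real
  assumes "0 \<le> z" "z < 1"
  shows "summable (\<lambda>n. z ^ n * (real (2 * (r + n) + 1)) ^ m)"
proof -
  define y where "y = root (Suc m) z"
  have y: "0 \<le> y" "y < 1" "y ^ Suc m = z"
    using assms real_root_pow_pos2[of "Suc m" z] by (simp_all add: y_def del: power_Suc)
  have "(\<lambda>n. 2 * (real n * y ^ n) + (2 * real r + 1) * y ^ n) \<longlonglongrightarrow> 2 * 0 + (2 * real r + 1) * 0"
    using y by (intro tendsto_add tendsto_mult tendsto_const powser_times_n_limit_0 LIMSEQ_realpow_zero) auto
  then have "Bseq (\<lambda>n. 2 * (real n * y ^ n) + (2 * real r + 1) * y ^ n)"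
    by (rule convergent_imp_Bseq[OF convergentI])
  then obtain K where K: "\<And>n. norm (2 * (real n * y ^ n) + (2 * real r + 1) * y ^ n) \<le> K"
    by (elim BseqE) blast
  have K0: "0 \<le> K" using order_trans[OF norm_ge_zero K[of 0]] .
  show ?thesis
  proof (rule summable_comparison_test')
    show "summable (\<lambda>n. K ^ m * y ^ n)"
      using y by (intro summable_mult summable_geometric) auto
    fix n
    have "z ^ n * (real (2 * (r + n) + 1)) ^ m = (2 * (real n * y ^ n) + (2 * real r + 1) * y ^ n) ^ m * y ^ n"
    proof -
      have "z ^ n = (y ^ n) ^ m * y ^ n"
        unfolding y(3)[symmetric] by (simp add: power_mult_distrib mult.commute flip: power_mult)
      moreover have "2 * (real n * y ^ n) + (2 * real r + 1) * y ^ n = real (2 * (r + n) + 1) * y ^ n"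
        by (simp add: algebra_simps)
      ultimately show ?thesis by (simp add: power_mult_distrib)
    qed
    also have "norm \<dots> \<le> K ^ m * y ^ n"
      unfolding norm_mult norm_power using K[of n] K0 y
      by (intro mult_mono power_mono zero_le_power) auto
    finally show "norm (z ^ n * (real (2 * (r + n) + 1)) ^ m) \<le> K ^ m * y ^ n" .
  qed
qed

lemma inverse_cp_le_1:
  assumes fin: "\<And>z i j. 0 \<le> z \<Longrightarrow> z < 1 \<Longrightarrow> i \<in> I \<Longrightarrow> j \<in> I \<Longrightarrow>
      (\<Sum>n. ennreal (z ^ n) * mat_pow I A n i j) < \<infinity>"
  shows "inverse (cp I A) \<le> 1"
proof -
  have "1 \<le> cp I A"
  proof (rule dense_le)
    fix y :: ennreal assume y: "y < 1"
    then have "y < top" using less_trans by fastforce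
    then obtain r where r: "y = ennreal r" "0 \<le> r" by (cases y) auto
    with y have "r < 1" by (simp add: ennreal_less_one_iff)
    show "y \<le> cp I A"
      unfolding cp_def by (rule Sup_upper) (use r \<open>r < 1\<close> fin in auto)
  qed
  then show ?thesis
    by (cases "cp I A") (auto simp: inverse_ennreal ennreal_ge_1 ennreal_le_1 field_simps)
qed

text \<open>Forgetting the level of \<open>Q_star P (\<beta> - {b}) b 0\<close> sends its edges to
  edges of \<open>P_star P \<beta> \<theta>\<close>: the change of level becomes the
  \<open>b\<close> component of the jump.\<close>

lemma irreducible_P_star:
  fixes P :: "('d::finite, 's::finite) state \<Rightarrow> ('d, 's) state \<Rightarrow> real"
  assumes P: "qbd_matrix P" and b: "b \<in> \<beta>"
    and irr: "irreducible_mat (UNIV \<times> indices (- (\<beta> - {b}) - {b})) (Q_star P (\<beta> - {b}) b 0)"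
  shows "irreducible_mat (indices (- \<beta>)) (P_star P \<beta> \<theta>)"
proof -
  have I: "- (\<beta> - {b}) - {b} = - \<beta>" using b by auto
  have pos: "0 < P_star P \<beta> \<theta> (u, j) (u', j')"
    if q: "0 < Q_star P (\<beta> - {b}) b 0 (m, u, j) (m', u', j')" for m u j m' u' j'
  proof (rule Q_star_posD[OF P q])
    fix l
    assume m: "\<bar>int m' - int m\<bar> \<le> 1" and l: "l \<in> \<beta> - {b} \<rightarrow>\<^sub>E {-1, 0, 1}"
      and p: "0 < P (override_on (u(b := 2)) (\<lambda>i. 2) (\<beta> - {b}), j)
         (override_on (u'(b := nat (2 + (int m' - int m)))) (\<lambda>i. nat (2 + l i)) (\<beta> - {b}), j')"
    define l' where "l' = l(b := int m' - int m)"
    have "int m' - int m \<in> {-1, 0, 1}" using m by auto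
    then have "l' \<in> insert b (\<beta> - {b}) \<rightarrow>\<^sub>E {-1, 0, 1}"
      unfolding l'_def using l by (intro PiE_fun_upd)
    moreover have "insert b (\<beta> - {b}) = \<beta>" using b by auto
    moreover have "override_on (u(b := 2)) (\<lambda>i. 2) (\<beta> - {b}) = override_on u (\<lambda>i. 2) \<beta>"
      using b by (auto simp: override_on_def)
    moreover have "override_on (u'(b := nat (2 + (int m' - int m)))) (\<lambda>i. nat (2 + l i)) (\<beta> - {b}) =
        override_on u' (\<lambda>i. nat (2 + l' i)) \<beta>"
      using b by (auto simp: override_on_def l'_def)
    ultimately show ?thesis
      unfolding P_star_pos_iff[OF P] using p by (metis (no_types, lifting))
  qed simp
  show ?thesis
    unfolding irreducible_mat_def
  proof (intro ballI)
    fix h h' :: "('d, 's) state" assume h: "h \<in> indices (- \<beta>)" "h' \<in> indices (- \<beta>)"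
    then obtain n where n: "0 < mat_pow (UNIV \<times> indices (- \<beta>)) (Q_star P (\<beta> - {b}) b 0) n (0, h) (0, h')"
      using irr unfolding irreducible_mat_def I by fastforce
    have "0 < mat_pow (indices (- \<beta>)) (P_star P \<beta> \<theta>) n (snd (0 :: nat, h)) (snd (0 :: nat, h'))"
      by (rule mat_pow_map_pos[OF _ _ _ _ n]) (use h pos in auto)
    then show "\<exists>n. 0 < mat_pow (indices (- \<beta>)) (P_star P \<beta> \<theta>) n h h'" by auto
  qed
qed

text \<open>The hypothesis \<open>loops\<close> bounds each term of the exponential sum for a
  diagonal entry by 1, so the entry is at most the number of points in a cube of side 2n+1. Such
  polynomial growth means convergence for all z < 1, and irreducibility spreads it from one diagonal
  entry to all entries.\<close>

lemma Gamma_barI: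
  fixes P :: "('d::finite, 's::finite) state \<Rightarrow> ('d, 's) state \<Rightarrow> real"
  assumes P: "qbd_matrix P"
    and irr: "irreducible_mat (indices (- \<beta>)) (P_star P \<beta> \<theta>)"
    and loops: "\<And>n z z'. (\<And>i. i \<in> \<beta> \<Longrightarrow> n + 1 \<le> z i) \<Longrightarrow> (\<And>i. i \<notin> \<beta> \<Longrightarrow> z i = x i \<and> z' i = x i) \<Longrightarrow>
       mat_pow UNIV P n (z, j) (z', j) \<le> ennreal (exp (- (\<Sum>i\<in>\<beta>. (real (z' i) - real (z i)) * \<theta> $ i)))"
  shows "\<theta> \<in> Gamma_bar P \<beta>"
proof -
  let ?I = "indices (- \<beta>) :: ('d, 's) state set"
  let ?A = "P_star P \<beta> \<theta>"
  define x0 where "x0 = (restrict x (- \<beta>), j)"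
  have x0: "x0 \<in> ?I" by (auto simp: x0_def indices_def)
  have diag: "mat_pow ?I ?A n x0 x0 \<le> ennreal (real (2 * n + 1) ^ card \<beta>)" for n
  proof -
    define z :: "'d \<Rightarrow> nat" where "z = (\<lambda>i. n + 1)"
    have "mat_pow ?I ?A n x0 x0 \<le>
      (\<Sum>w\<in>nat_box \<beta> z n. ennreal (exp (\<Sum>i\<in>\<beta>. (real (w i) - real (z i)) * \<theta> $ i)) *
       mat_pow UNIV P n (override_on (restrict x (- \<beta>)) z \<beta>, j) (override_on (restrict x (- \<beta>)) w \<beta>, j))"
      unfolding x0_def by (rule mat_pow_P_star_le[OF P]) (use x0 in \<open>auto simp: z_def x0_def\<close>)
    also have "\<dots> \<le> (\<Sum>w\<in>nat_box \<beta> z n. 1)"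
    proof (rule sum_mono)
      fix w
      let ?y = "override_on (restrict x (- \<beta>)) z \<beta>" and ?y' = "override_on (restrict x (- \<beta>)) w \<beta>"
      have "mat_pow UNIV P n (?y, j) (?y', j) \<le> ennreal (exp (- (\<Sum>i\<in>\<beta>. (real (?y' i) - real (?y i)) * \<theta> $ i)))"
        by (rule loops) (auto simp: z_def override_on_def)
      also have "(\<Sum>i\<in>\<beta>. (real (?y' i) - real (?y i)) * \<theta> $ i) = (\<Sum>i\<in>\<beta>. (real (w i) - real (z i)) * \<theta> $ i)"
        by (intro sum.cong) (auto simp: override_on_def)
      finally have "ennreal (exp (\<Sum>i\<in>\<beta>. (real (w i) - real (z i)) * \<theta> $ i)) * mat_pow UNIV P n (?y, j) (?y', j) \<le>
          ennreal (exp (\<Sum>i\<in>\<beta>. (real (w i) - real (z i)) * \<theta> $ i)) * ennreal (exp (- (\<Sum>i\<in>\<beta>. (real (w i) - real (z i)) * \<theta> $ i)))"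
        by (rule mult_left_mono) simp
      then show "ennreal (exp (\<Sum>i\<in>\<beta>. (real (w i) - real (z i)) * \<theta> $ i)) * mat_pow UNIV P n (?y, j) (?y', j) \<le> 1"
        by (simp add: ennreal_mult[symmetric] exp_add[symmetric])
    qed
    also have "\<dots> = ennreal (real (2 * n + 1) ^ card \<beta>)"
    proof -
      have "card (nat_box \<beta> z n) = (2 * n + 1) ^ card \<beta>"
        by (simp add: card_PiE z_def mult_2)
      then show ?thesis
        by (metis ennreal_of_nat_eq_real_of_nat of_nat_power sum_constant mult.right_neutral)
    qed
    finally show ?thesis .
  qed
  have "inverse (cp ?I ?A) \<le> 1"
  proof (rule inverse_cp_le_1)
    fix z :: real and a b :: "('d, 's) state"
    assume z: "0 \<le> z" "z < 1" and ab: "a \<in> ?I" "b \<in> ?I"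
    obtain r s where r: "0 < mat_pow ?I ?A r x0 a" and s: "0 < mat_pow ?I ?A s b x0"
      using irr ab x0 unfolding irreducible_mat_def by meson
    \<comment> \<open>A path from \<open>x0\<close> to \<open>a\<close> and one from
      \<open>b\<close> back to \<open>x0\<close>: up to the factor \<open>c\<close>, the entry at
      \<open>a\<close>, \<open>b\<close> is dominated by a diagonal entry of the power
      \<open>r + n + s\<close>.\<close>
    define c where "c = min 1 (mat_pow ?I ?A r x0 a * mat_pow ?I ?A s b x0)"
    have c: "0 < c" "c \<le> 1" using r s by (auto simp: c_def ennreal_zero_less_mult_iff)
    have bound: "c * mat_pow ?I ?A n a b \<le> ennreal (real (2 * ((r + s) + n) + 1) ^ card \<beta>)" for n
    proof -
      have "c * mat_pow ?I ?A n a b \<le> (mat_pow ?I ?A r x0 a * mat_pow ?I ?A s b x0) * mat_pow ?I ?A n a b"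
        by (rule mult_right_mono) (auto simp: c_def)
      also have "\<dots> = mat_pow ?I ?A r x0 a * (mat_pow ?I ?A n a b * mat_pow ?I ?A s b x0)"
        by (simp add: ac_simps)
      also have "\<dots> \<le> mat_pow ?I ?A r x0 a * mat_pow ?I ?A (n + s) a x0"
        using ab by (intro mult_left_mono mat_pow_add_ge) auto
      also have "\<dots> \<le> mat_pow ?I ?A (r + (n + s)) x0 x0"
        using ab by (intro mat_pow_add_ge)
      also have "\<dots> \<le> ennreal (real (2 * (r + (n + s)) + 1) ^ card \<beta>)" by (rule diag)
      finally show ?thesis by (simp add: ac_simps)
    qed
    have "c * (\<Sum>n. ennreal (z ^ n) * mat_pow ?I ?A n a b) = (\<Sum>n. ennreal (z ^ n) * (c * mat_pow ?I ?A n a b))"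
      by (simp add: ac_simps flip: ennreal_suminf_cmult)
    also have "\<dots> \<le> (\<Sum>n. ennreal (z ^ n * real (2 * ((r + s) + n) + 1) ^ card \<beta>))"
    proof (rule suminf_le)
      fix n
      show "ennreal (z ^ n) * (c * mat_pow ?I ?A n a b) \<le> ennreal (z ^ n * real (2 * ((r + s) + n) + 1) ^ card \<beta>)"
        using mult_left_mono[OF bound[of n], of "ennreal (z ^ n)"] z by (simp add: ennreal_mult)
    qed auto
    also have "\<dots> < \<infinity>"
    proof -
      have "(\<Sum>n. ennreal (z ^ n * real (2 * ((r + s) + n) + 1) ^ card \<beta>)) \<noteq> top"
        by (rule ennreal_suminf_neq_top[OF summable_polynomial_geometric[OF z]]) (use z in simp)
      then show ?thesis unfolding infinity_ennreal_def by (simp only: less_top)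
    qed
    finally have "c * (\<Sum>n. ennreal (z ^ n) * mat_pow ?I ?A n a b) < \<infinity>" .
    then show "(\<Sum>n. ennreal (z ^ n) * mat_pow ?I ?A n a b) < \<infinity>"
      using c(1) by (auto simp: ennreal_mult_less_top)
  qed
  then show ?thesis by (simp add: Gamma_bar_def)
qed

section \<open>Moving coordinates and repeating loops\<close>

text \<open>Both irreducibility hypotheses on the truncations in one: for empty \<alpha> the matrix
  is \<open>Q_mat P k\<close>.\<close>

definition Q_star_irreducible :: "(('d::finite, 's::finite) state \<Rightarrow> ('d, 's) state \<Rightarrow> real) \<Rightarrow> bool" where
  "Q_star_irreducible P \<longleftrightarrow>
    (\<forall>\<alpha> k. k \<notin> \<alpha> \<longrightarrow> irreducible_mat (UNIV \<times> indices (- \<alpha> - {k})) (Q_star P \<alpha> k 0))"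

text \<open>Irreducibility joins any two configurations of the coordinates outside \<alpha>; the
  drift \<open>l\<close> inside \<alpha> is whatever the path produces. The cost is rounded up to a
  natural number so that later estimates are integer arithmetic.\<close>

lemma Q_star_connection:
  fixes P :: "('d::finite, 's::finite) state \<Rightarrow> ('d, 's) state \<Rightarrow> real"
  assumes P: "qbd_matrix P" and irr: "Q_star_irreducible P" and k: "k \<notin> \<alpha>"
  shows "\<exists>(c::nat) (K::nat) l. (\<forall>i\<in>\<alpha>. \<bar>l i\<bar> \<le> int K) \<and>
    (\<forall>z z' t. (\<forall>i\<in>\<alpha>. K + 1 \<le> z i \<and> int (z' i) = int (z i) + l i) \<longrightarrow>
       (\<forall>i. i \<notin> \<alpha> \<longrightarrow> i \<noteq> k \<longrightarrow> z i = x i \<and> z' i = x' i) \<longrightarrow>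
       z k = m + t + 1 \<longrightarrow> z' k = m' + t + 1 \<longrightarrow> cost_le P (real c) (z, j) (z', j'))"
proof -
  define u u' where "u = restrict x (- \<alpha> - {k})" and "u' = restrict x' (- \<alpha> - {k})"
  have "(m, u, j) \<in> UNIV \<times> indices (- \<alpha> - {k})" "(m', u', j') \<in> UNIV \<times> indices (- \<alpha> - {k})"
    by (auto simp: indices_def u_def u'_def)
  then obtain n where n: "0 < mat_pow (UNIV \<times> indices (- \<alpha> - {k})) (Q_star P \<alpha> k 0) n (m, u, j) (m', u', j')"
    using irr k unfolding Q_star_irreducible_def irreducible_mat_def by meson
  obtain c l where l: "\<forall>i\<in>\<alpha>. \<bar>l i\<bar> \<le> int n"
    and c: "\<And>z z' t. (\<forall>i\<in>\<alpha>. n + 1 \<le> z i \<and> int (z' i) = int (z i) + l i) \<Longrightarrow>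
       (\<forall>i. i \<notin> \<alpha> \<longrightarrow> i \<noteq> k \<longrightarrow> z i = u i \<and> z' i = u' i) \<Longrightarrow>
       z k = m + t + 1 \<Longrightarrow> z' k = m' + t + 1 \<Longrightarrow> cost_le P c (z, j) (z', j')"
    using Q_star_path_cost[OF P k n] by blast
  have "cost_le P (real (nat \<lceil>c\<rceil>)) (z, j) (z', j')"
    if "\<forall>i\<in>\<alpha>. n + 1 \<le> z i \<and> int (z' i) = int (z i) + l i"
      "\<forall>i. i \<notin> \<alpha> \<longrightarrow> i \<noteq> k \<longrightarrow> z i = x i \<and> z' i = x' i"
      "z k = m + t + 1" "z' k = m' + t + 1" for z z' t
    by (rule cost_le_mono[OF c[of z z' t]]) (use that in \<open>auto simp: u_def u'_def real_nat_ceiling_ge\<close>)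
  then show ?thesis
    by (intro exI[of _ "nat \<lceil>c\<rceil>"] exI[of _ n] exI[of _ l] conjI allI impI) (use l in auto)
qed

text \<open>A path between levels 0 and 1 that restores all coordinates outside \<alpha> and
  \<open>k\<close> is repeated \<open>R\<close> times. The repetitions may lose \<open>R * K\<close>
  of height, and each needs \<open>K + 1\<close> at its start; hence the requirement on
  \<open>z\<close>.\<close>

lemma raise_lower:
  fixes P :: "('d::finite, 's::finite) state \<Rightarrow> ('d, 's) state \<Rightarrow> real"
  assumes P: "qbd_matrix P" and irr: "Q_star_irreducible P" and k: "k \<notin> \<alpha>"
  obtains c K :: nat where
    "\<And>R z. (\<And>i. i \<in> \<alpha> \<Longrightarrow> R * K + K + 1 \<le> z i) \<Longrightarrow> (\<And>i. i \<notin> \<alpha> \<Longrightarrow> i \<noteq> k \<Longrightarrow> z i = x i) \<Longrightarrow> 1 \<le> z k \<Longrightarrow>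
      \<exists>z'. (\<forall>i\<in>\<alpha>. \<bar>int (z' i) - int (z i)\<bar> \<le> int (R * K)) \<and> (\<forall>i. i \<notin> \<alpha> \<longrightarrow> i \<noteq> k \<longrightarrow> z' i = x i) \<and>
        z' k = z k + R \<and> cost_le P (real (R * c)) (z, j) (z', j)"
    "\<And>R z. (\<And>i. i \<in> \<alpha> \<Longrightarrow> R * K + K + 1 \<le> z i) \<Longrightarrow> (\<And>i. i \<notin> \<alpha> \<Longrightarrow> i \<noteq> k \<Longrightarrow> z i = x i) \<Longrightarrow> R < z k \<Longrightarrow>
      \<exists>z'. (\<forall>i\<in>\<alpha>. \<bar>int (z' i) - int (z i)\<bar> \<le> int (R * K)) \<and> (\<forall>i. i \<notin> \<alpha> \<longrightarrow> i \<noteq> k \<longrightarrow> z' i = x i) \<and>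
        z' k = z k - R \<and> cost_le P (real (R * c)) (z, j) (z', j)"
proof -
  obtain c1 K1 :: nat and l1 where l1: "\<forall>i\<in>\<alpha>. \<bar>l1 i\<bar> \<le> int K1"
    and c1: "\<And>z z' t. (\<forall>i\<in>\<alpha>. K1 + 1 \<le> z i \<and> int (z' i) = int (z i) + l1 i) \<Longrightarrow>
       (\<forall>i. i \<notin> \<alpha> \<longrightarrow> i \<noteq> k \<longrightarrow> z i = x i \<and> z' i = x i) \<Longrightarrow>
       z k = 0 + t + 1 \<Longrightarrow> z' k = 1 + t + 1 \<Longrightarrow> cost_le P (real c1) (z, j) (z', j)"
    using Q_star_connection[OF P irr k, of x x 0 1 j j] by blast
  obtain c2 K2 :: nat and l2 where l2: "\<forall>i\<in>\<alpha>. \<bar>l2 i\<bar> \<le> int K2"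
    and c2: "\<And>z z' t. (\<forall>i\<in>\<alpha>. K2 + 1 \<le> z i \<and> int (z' i) = int (z i) + l2 i) \<Longrightarrow>
       (\<forall>i. i \<notin> \<alpha> \<longrightarrow> i \<noteq> k \<longrightarrow> z i = x i \<and> z' i = x i) \<Longrightarrow>
       z k = 1 + t + 1 \<Longrightarrow> z' k = 0 + t + 1 \<Longrightarrow> cost_le P (real c2) (z, j) (z', j)"
    using Q_star_connection[OF P irr k, of x x 1 0 j j] by blast
  define c K where "c = max c1 c2" and "K = max K1 K2"
  \<comment> \<open>Both directions at once: \<open>s\<close> is 1 for raising and -1 for
    lowering.\<close>
  have gen: "\<exists>z'. (\<forall>i\<in>\<alpha>. \<bar>int (z' i) - int (z i)\<bar> \<le> int (R * K)) \<and> (\<forall>i. i \<notin> \<alpha> \<longrightarrow> i \<noteq> k \<longrightarrow> z' i = x i) \<and>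
        int (z' k) = int (z k) + int R * s \<and> cost_le P (real (R * c)) (z, j) (z', j)"
    if z: "\<And>i. i \<in> \<alpha> \<Longrightarrow> R * K + K + 1 \<le> z i" "\<And>i. i \<notin> \<alpha> \<Longrightarrow> i \<noteq> k \<Longrightarrow> z i = x i"
      and zk: "\<And>r. r \<le> R \<Longrightarrow> 1 \<le> int (z k) + int r * s"
      and l: "\<And>i. i \<in> \<alpha> \<Longrightarrow> \<bar>l i\<bar> \<le> int K"
      and step: "\<And>y y'. (\<forall>i\<in>\<alpha>. K + 1 \<le> y i \<and> int (y' i) = int (y i) + l i) \<Longrightarrow>
        (\<forall>i. i \<notin> \<alpha> \<longrightarrow> i \<noteq> k \<longrightarrow> y i = x i \<and> y' i = x i) \<Longrightarrow>
        1 \<le> y k \<Longrightarrow> 1 \<le> y' k \<Longrightarrow> int (y' k) = int (y k) + s \<Longrightarrow> cost_le P (real c) (y, j) (y', j)"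
    for R z and s :: int and l :: "'d \<Rightarrow> int"
  proof -
    define f where "f r i = (if i \<in> \<alpha> then nat (int (z i) + int r * l i)
      else if i = k then nat (int (z k) + int r * s) else z i)" for r i
    have f\<alpha>: "int (f r i) = int (z i) + int r * l i" "\<bar>int r * l i\<bar> \<le> int (R * K)" "K + 1 \<le> f r i"
      if "r \<le> R" "i \<in> \<alpha>" for r i
    proof -
      have "\<bar>int r * l i\<bar> \<le> int R * int K"
        unfolding abs_mult using that l by (intro mult_mono) auto
      then show *: "\<bar>int r * l i\<bar> \<le> int (R * K)" by simp
      have "int (R * K) + int K + 1 \<le> int (z i)" using z(1)[OF that(2)] by linarith
      with * have "int K + 1 \<le> int (z i) + int r * l i" by linarith
      then show "int (f r i) = int (z i) + int r * l i" "K + 1 \<le> f r i"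
        using that(2) by (simp_all add: f_def le_nat_iff)
    qed
    have fk: "int (f r k) = int (z k) + int r * s" "1 \<le> f r k" if "r \<le> R" for r
      using zk[OF that] k by (auto simp: f_def)
    have "cost_le P (real R * real c) (f 0, j) (f R, j)"
    proof (rule cost_le_iterate[where f = "\<lambda>r. (f r, j)"])
      fix r assume r: "r < R"
      show "cost_le P (real c) (f r, j) (f (Suc r), j)"
      proof (rule step)
        show "\<forall>i\<in>\<alpha>. K + 1 \<le> f r i \<and> int (f (Suc r) i) = int (f r i) + l i"
          using f\<alpha>[of r] f\<alpha>[of "Suc r"] r by (auto simp: algebra_simps)
        show "\<forall>i. i \<notin> \<alpha> \<longrightarrow> i \<noteq> k \<longrightarrow> f r i = x i \<and> f (Suc r) i = x i"
          using z(2) by (auto simp: f_def)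
        show "1 \<le> f r k" "1 \<le> f (Suc r) k" "int (f (Suc r) k) = int (f r k) + s"
          using fk[of r] fk[of "Suc r"] r by (auto simp: algebra_simps)
      qed
    qed
    moreover have "f 0 = z" by (auto simp: f_def)
    ultimately show ?thesis
      using f\<alpha>[of R] fk[of R] z(2) by (intro exI[of _ "f R"]) (auto simp: f_def)
  qed
  \<comment> \<open>Level 0 stands for height 1, so the translation is by the lower of the two
    heights minus 1: \<open>y k - 1\<close> here and \<open>y' k - 1\<close> in
    \<open>down\<close>.\<close>
  have up: "cost_le P (real c) (y, j) (y', j)"
    if "\<forall>i\<in>\<alpha>. K + 1 \<le> y i \<and> int (y' i) = int (y i) + l1 i"
       "\<forall>i. i \<notin> \<alpha> \<longrightarrow> i \<noteq> k \<longrightarrow> y i = x i \<and> y' i = x i"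
       "1 \<le> y k" "int (y' k) = int (y k) + 1" for y y'
    by (rule cost_le_mono[OF c1[of y y' "y k - 1"]]) (use that in \<open>auto simp: K_def c_def\<close>)
  have down: "cost_le P (real c) (y, j) (y', j)"
    if "\<forall>i\<in>\<alpha>. K + 1 \<le> y i \<and> int (y' i) = int (y i) + l2 i"
       "\<forall>i. i \<notin> \<alpha> \<longrightarrow> i \<noteq> k \<longrightarrow> y i = x i \<and> y' i = x i"
       "1 \<le> y' k" "int (y' k) = int (y k) - 1" for y y'
    by (rule cost_le_mono[OF c2[of y y' "y' k - 1"]]) (use that in \<open>auto simp: K_def c_def\<close>)
  show ?thesis
  proof (rule that[of K c])
    fix R and z :: "'d \<Rightarrow> nat"
    assume z: "\<And>i. i \<in> \<alpha> \<Longrightarrow> R * K + K + 1 \<le> z i" "\<And>i. i \<notin> \<alpha> \<Longrightarrow> i \<noteq> k \<Longrightarrow> z i = x i"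
    {
      assume "1 \<le> z k"
      then have "\<exists>z'. (\<forall>i\<in>\<alpha>. \<bar>int (z' i) - int (z i)\<bar> \<le> int (R * K)) \<and> (\<forall>i. i \<notin> \<alpha> \<longrightarrow> i \<noteq> k \<longrightarrow> z' i = x i) \<and>
        int (z' k) = int (z k) + int R * 1 \<and> cost_le P (real (R * c)) (z, j) (z', j)"
        using l1 by (intro gen[of R z 1 l1] z up) (auto simp: K_def)
      then show "\<exists>z'. (\<forall>i\<in>\<alpha>. \<bar>int (z' i) - int (z i)\<bar> \<le> int (R * K)) \<and> (\<forall>i. i \<notin> \<alpha> \<longrightarrow> i \<noteq> k \<longrightarrow> z' i = x i) \<and>
        z' k = z k + R \<and> cost_le P (real (R * c)) (z, j) (z', j)"
        by (elim exE conjE, intro exI conjI) (assumption | linarith)+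
    next
      assume R: "R < z k"
      then have "\<exists>z'. (\<forall>i\<in>\<alpha>. \<bar>int (z' i) - int (z i)\<bar> \<le> int (R * K)) \<and> (\<forall>i. i \<notin> \<alpha> \<longrightarrow> i \<noteq> k \<longrightarrow> z' i = x i) \<and>
        int (z' k) = int (z k) + int R * (- 1) \<and> cost_le P (real (R * c)) (z, j) (z', j)"
        using l2 by (intro gen[of R z "- 1" l2] z down) (auto simp: K_def)
      then show "\<exists>z'. (\<forall>i\<in>\<alpha>. \<bar>int (z' i) - int (z i)\<bar> \<le> int (R * K)) \<and> (\<forall>i. i \<notin> \<alpha> \<longrightarrow> i \<noteq> k \<longrightarrow> z' i = x i) \<and>
        z' k = z k - R \<and> cost_le P (real (R * c)) (z, j) (z', j)"
        using R by (elim exE conjE, intro exI conjI) (assumption | linarith)+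
    }
  qed
qed

text \<open>
  Moving coordinate \<open>b\<close> by \<open>R\<close> displaces the coordinates treated earlier by at most \<open>R * K\<close>;
  hence these are raised to the larger height \<open>M'\<close> before, and lowered after, \<open>b\<close>. The
  deviation of \<open>z'\<close> from \<open>z\<close> leaves room for the main part of the path.
\<close>

lemma raise_and_lower_all:
  fixes P :: "('d::finite, 's::finite) state \<Rightarrow> ('d, 's) state \<Rightarrow> real"
  assumes P: "qbd_matrix P" and irr: "Q_star_irreducible P"
    and "finite \<gamma>" "k \<notin> \<gamma>" and x: "\<forall>i\<in>insert k \<gamma>. 1 \<le> x i"
  shows "\<exists>C::nat. \<forall>M. \<exists>z. (\<forall>i\<in>insert k \<gamma>. M \<le> z i) \<and> (\<forall>i. i \<notin> insert k \<gamma> \<longrightarrow> z i = x i) \<and>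
    z k \<le> C * (M + 1) \<and> cost_le P (real (C * (M + 1))) (x, j) (z, j) \<and>
    (\<forall>z'. (\<forall>i. i \<notin> insert k \<gamma> \<longrightarrow> z' i = x i) \<longrightarrow> (\<forall>i\<in>\<gamma>. \<bar>int (z' i) - int (z i)\<bar> \<le> int M) \<longrightarrow>
       z k \<le> z' k + M \<longrightarrow>
       (\<exists>n\<ge>1. \<bar>int n - int (z' k)\<bar> \<le> int (C * (M + 1)) \<and>
          cost_le P (real (C * (M + 1))) (z', j) (x(k := n), j)))"
  using assms(3-5)
proof (induction \<gamma>)
  case empty
  obtain c K :: nat where up:
    "\<And>R z. (\<And>i. i \<in> {} \<Longrightarrow> R * K + K + 1 \<le> z i) \<Longrightarrow> (\<And>i. i \<notin> {} \<Longrightarrow> i \<noteq> k \<Longrightarrow> z i = x i) \<Longrightarrow> 1 \<le> z k \<Longrightarrow>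
      \<exists>z'. (\<forall>i\<in>{}. \<bar>int (z' i) - int (z i)\<bar> \<le> int (R * K)) \<and> (\<forall>i. i \<notin> {} \<longrightarrow> i \<noteq> k \<longrightarrow> z' i = x i) \<and>
        z' k = z k + R \<and> cost_le P (real (R * c)) (z, j) (z', j)"
    using raise_lower[OF P irr, of k "{}" x j] by (metis empty_iff)
  \<comment> \<open>\<open>c\<close> pays for raising \<open>k\<close> by \<open>M\<close>, and
    \<open>x k + 1\<close> bounds the height reached. In this case nothing is lowered: the returned
    \<open>n\<close> is \<open>z' k\<close> itself.\<close>
  define C where "C = c + x k + 1"
  show ?case
  proof (intro exI[of _ C] allI)
    fix M
    obtain z where z: "\<forall>i. i \<noteq> k \<longrightarrow> z i = x i" "z k = x k + M" "cost_le P (real (M * c)) (x, j) (z, j)"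
      using up[of M x] empty by auto
    define D where "D = C * (M + 1)"
    have D: "M * c \<le> D" "x k + M \<le> D" by (simp_all add: D_def C_def algebra_simps)
    have cost: "cost_le P (real D) (x, j) (z, j)"
      by (rule cost_le_mono[OF z(3)]) (use D(1) in \<open>simp only: of_nat_le_iff\<close>)
    have return: "\<exists>n\<ge>1. \<bar>int n - int (z' k)\<bar> \<le> int D \<and> cost_le P (real D) (z', j) (x(k := n), j)"
      if z': "\<forall>i. i \<notin> insert k {} \<longrightarrow> z' i = x i" "z k \<le> z' k + M" for z'
    proof -
      have "z' = x(k := z' k)" using z' by auto
      then have "cost_le P (real D) (z', j) (x(k := z' k), j)"
        by (metis cost_le_mono cost_le_refl of_nat_0_le_iff)
      moreover have "1 \<le> z' k" using z'(2) z(2) empty by simp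
      ultimately show ?thesis by (intro exI[of _ "z' k"]) simp
    qed
    have "\<forall>i\<in>insert k {}. M \<le> z i" "\<forall>i. i \<notin> insert k {} \<longrightarrow> z i = x i" "z k \<le> D"
      using z D(2) by auto
    then show "\<exists>z. (\<forall>i\<in>insert k {}. M \<le> z i) \<and> (\<forall>i. i \<notin> insert k {} \<longrightarrow> z i = x i) \<and>
      z k \<le> C * (M + 1) \<and> cost_le P (real (C * (M + 1))) (x, j) (z, j) \<and>
      (\<forall>z'. (\<forall>i. i \<notin> insert k {} \<longrightarrow> z' i = x i) \<longrightarrow> (\<forall>i\<in>{}. \<bar>int (z' i) - int (z i)\<bar> \<le> int M) \<longrightarrow>
       z k \<le> z' k + M \<longrightarrow>
       (\<exists>n\<ge>1. \<bar>int n - int (z' k)\<bar> \<le> int (C * (M + 1)) \<and>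
          cost_le P (real (C * (M + 1))) (z', j) (x(k := n), j)))"
      unfolding D_def[symmetric] using cost return by blast
  qed
next
  case (insert b \<gamma>)
  let ?\<beta> = "insert k \<gamma>"
  have b: "b \<notin> ?\<beta>" and ib: "insert k (insert b \<gamma>) = insert b ?\<beta>" and bk: "b \<noteq> k"
    using insert by auto
  obtain c K :: nat where
    up: "\<And>R z. (\<And>i. i \<in> ?\<beta> \<Longrightarrow> R * K + K + 1 \<le> z i) \<Longrightarrow> (\<And>i. i \<notin> ?\<beta> \<Longrightarrow> i \<noteq> b \<Longrightarrow> z i = x i) \<Longrightarrow> 1 \<le> z b \<Longrightarrow>
      \<exists>z'. (\<forall>i\<in>?\<beta>. \<bar>int (z' i) - int (z i)\<bar> \<le> int (R * K)) \<and> (\<forall>i. i \<notin> ?\<beta> \<longrightarrow> i \<noteq> b \<longrightarrow> z' i = x i) \<and>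
        z' b = z b + R \<and> cost_le P (real (R * c)) (z, j) (z', j)" and
    down: "\<And>R z. (\<And>i. i \<in> ?\<beta> \<Longrightarrow> R * K + K + 1 \<le> z i) \<Longrightarrow> (\<And>i. i \<notin> ?\<beta> \<Longrightarrow> i \<noteq> b \<Longrightarrow> z i = x i) \<Longrightarrow> R < z b \<Longrightarrow>
      \<exists>z'. (\<forall>i\<in>?\<beta>. \<bar>int (z' i) - int (z i)\<bar> \<le> int (R * K)) \<and> (\<forall>i. i \<notin> ?\<beta> \<longrightarrow> i \<noteq> b \<longrightarrow> z' i = x i) \<and>
        z' b = z b - R \<and> cost_le P (real (R * c)) (z, j) (z', j)"
    by (rule raise_lower[OF P irr b, of x j]) blast
  have prems: "k \<notin> \<gamma>" "\<forall>i\<in>?\<beta>. 1 \<le> x i" using insert.prems by auto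
  obtain C :: nat where IH: "\<forall>M. \<exists>z. (\<forall>i\<in>?\<beta>. M \<le> z i) \<and> (\<forall>i. i \<notin> ?\<beta> \<longrightarrow> z i = x i) \<and>
    z k \<le> C * (M + 1) \<and> cost_le P (real (C * (M + 1))) (x, j) (z, j) \<and>
    (\<forall>z'. (\<forall>i. i \<notin> ?\<beta> \<longrightarrow> z' i = x i) \<longrightarrow> (\<forall>i\<in>\<gamma>. \<bar>int (z' i) - int (z i)\<bar> \<le> int M) \<longrightarrow>
       z k \<le> z' k + M \<longrightarrow>
       (\<exists>n\<ge>1. \<bar>int n - int (z' k)\<bar> \<le> int (C * (M + 1)) \<and>
          cost_le P (real (C * (M + 1))) (z', j) (x(k := n), j)))"
    using insert.IH[OF prems] by (rule exE)
  \<comment> \<open>The factor \<open>6 * K + 3\<close> comes from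
    \<open>M' + 1 \<le> (6 * K + 3) * (M + 1)\<close>. Coordinate \<open>b\<close> is raised by
    \<open>2 * M\<close> and lowered by at most \<open>3 * M\<close>, so \<open>3 * c\<close> covers
    the cost of either move and \<open>3 * K\<close> the displacement of \<open>k\<close> by
    it.\<close>
  define C' where "C' = C * (6 * K + 3) + 3 * c + 3 * K"
  show ?case
    unfolding ib
  proof (intro exI[of _ C'] allI)
    fix M :: nat
    \<comment> \<open>Raising \<open>b\<close> displaces the others by up to
      \<open>2 * (M * K)\<close>, lowering it by up to \<open>3 * (M * K)\<close>, the main part by
      \<open>M\<close>; \<open>K + 1\<close> is the margin required by
      \<open>raise_lower\<close>.\<close>
    define M' where "M' = M + 5 * (M * K) + K + 1"
    define E where "E = C * (M' + 1)"
    define F where "F = C' * (M + 1)"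
    obtain z0 where z0: "\<forall>i\<in>?\<beta>. M' \<le> z0 i" "\<forall>i. i \<notin> ?\<beta> \<longrightarrow> z0 i = x i" "z0 k \<le> E"
       "cost_le P (real E) (x, j) (z0, j)"
      and z0': "\<And>z'. (\<forall>i. i \<notin> ?\<beta> \<longrightarrow> z' i = x i) \<Longrightarrow> (\<forall>i\<in>\<gamma>. \<bar>int (z' i) - int (z0 i)\<bar> \<le> int M') \<Longrightarrow>
       z0 k \<le> z' k + M' \<Longrightarrow>
       (\<exists>n\<ge>1. \<bar>int n - int (z' k)\<bar> \<le> int E \<and> cost_le P (real E) (z', j) (x(k := n), j))"
      using IH[THEN spec, of M'] unfolding E_def by blast
    have x_b: "1 \<le> x b" using insert.prems by simp
    have "\<exists>z'. (\<forall>i\<in>?\<beta>. \<bar>int (z' i) - int (z0 i)\<bar> \<le> int (2 * M * K)) \<and> (\<forall>i. i \<notin> ?\<beta> \<longrightarrow> i \<noteq> b \<longrightarrow> z' i = x i) \<and>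
        z' b = z0 b + 2 * M \<and> cost_le P (real (2 * M * c)) (z0, j) (z', j)"
    proof (rule up)
      show "2 * M * K + K + 1 \<le> z0 i" if "i \<in> ?\<beta>" for i
        using z0(1) that by (fastforce simp: M'_def)
    qed (use z0 b x_b in auto)
    then obtain z1 where z1: "\<forall>i\<in>?\<beta>. \<bar>int (z1 i) - int (z0 i)\<bar> \<le> int (2 * (M * K))"
      "\<forall>i. i \<notin> ?\<beta> \<longrightarrow> i \<noteq> b \<longrightarrow> z1 i = x i" "z1 b = x b + 2 * M" "cost_le P (real (2 * M * c)) (z0, j) (z1, j)"
      using z0(2) b by (auto simp: mult.assoc)
    have E_le: "E \<le> C * ((6 * K + 3) * (M + 1))"
      unfolding E_def M'_def by (rule mult_left_mono) (auto simp: algebra_simps)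
    have F: "E + 3 * (M * c) + 3 * (M * K) \<le> F"
      using E_le by (simp add: F_def C'_def algebra_simps)
    have cost1: "cost_le P (real F) (x, j) (z1, j)"
    proof (rule cost_le_mono[OF cost_le_trans[OF z0(4) z1(4)]])
      show "real E + real (2 * M * c) \<le> real F"
        using F unfolding of_nat_add[symmetric] of_nat_le_iff by simp
    qed
    have z1_ge: "M' \<le> z1 i + 2 * (M * K)" if "i \<in> ?\<beta>" for i
      using bspec[OF z0(1) that] bspec[OF z1(1) that] by linarith
    have return: "\<exists>n\<ge>1. \<bar>int n - int (z' k)\<bar> \<le> int F \<and> cost_le P (real F) (z', j) (x(k := n), j)"
      if z': "\<forall>i. i \<notin> insert b ?\<beta> \<longrightarrow> z' i = x i" "\<forall>i\<in>insert b \<gamma>. \<bar>int (z' i) - int (z1 i)\<bar> \<le> int M"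
        "z1 k \<le> z' k + M" for z'
    proof -
      have "\<bar>int (z' b) - int (z1 b)\<bar> \<le> int M" using z'(2) by simp
      then have b_bounds: "x b + M \<le> z' b" "z' b \<le> x b + 3 * M" using z1(3) by linarith+
      \<comment> \<open>The main part changes \<open>b\<close> by at most \<open>M\<close>, so
        \<open>b\<close> still lies above \<open>x b\<close>; lowering by \<open>R\<close> restores
        it exactly.\<close>
      define R where "R = z' b - x b"
      have R: "R \<le> 3 * M" "z' b - R = x b" "R < z' b" using b_bounds x_b by (auto simp: R_def)
      have RK: "R * K \<le> 3 * (M * K)" "R * c \<le> 3 * (M * c)"
        using mult_right_mono[OF R(1), of K] mult_right_mono[OF R(1), of c] by (simp_all add: mult.assoc)
      have "\<exists>z''. (\<forall>i\<in>?\<beta>. \<bar>int (z'' i) - int (z' i)\<bar> \<le> int (R * K)) \<and> (\<forall>i. i \<notin> ?\<beta> \<longrightarrow> i \<noteq> b \<longrightarrow> z'' i = x i) \<and>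
        z'' b = z' b - R \<and> cost_le P (real (R * c)) (z', j) (z'', j)"
      proof (rule down)
        fix i assume i: "i \<in> ?\<beta>"
        have "z1 i \<le> z' i + M"
        \<comment> \<open>Coordinate \<open>k\<close> may climb freely in the main part, so only a
          lower bound on it is available.\<close>
        proof (cases "i = k")
          case False
          with i have "\<bar>int (z' i) - int (z1 i)\<bar> \<le> int M" using z'(2) by blast
          then show ?thesis by linarith
        qed (use z'(3) in simp)
        with z1_ge[OF i] RK show "R * K + K + 1 \<le> z' i" unfolding M'_def by linarith
      qed (use z' R in auto)
      then obtain z'' where z'': "\<forall>i\<in>?\<beta>. \<bar>int (z'' i) - int (z' i)\<bar> \<le> int (R * K)"
        "\<forall>i. i \<notin> ?\<beta> \<longrightarrow> z'' i = x i" "cost_le P (real (R * c)) (z', j) (z'', j)"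
        using R(2) by metis
      have "\<exists>n\<ge>1. \<bar>int n - int (z'' k)\<bar> \<le> int E \<and> cost_le P (real E) (z'', j) (x(k := n), j)"
      proof (rule z0'[OF z''(2)])
        show "\<forall>i\<in>\<gamma>. \<bar>int (z'' i) - int (z0 i)\<bar> \<le> int M'"
        proof
          fix i assume i: "i \<in> \<gamma>"
          then have "\<bar>int (z'' i) - int (z' i)\<bar> \<le> int (R * K)" "\<bar>int (z' i) - int (z1 i)\<bar> \<le> int M"
            "\<bar>int (z1 i) - int (z0 i)\<bar> \<le> int (2 * (M * K))"
            using z''(1) z'(2) z1(1) by blast+
          then show "\<bar>int (z'' i) - int (z0 i)\<bar> \<le> int M'"
            using RK(1) unfolding M'_def by linarith
        qed
        have "\<bar>int (z'' k) - int (z' k)\<bar> \<le> int (R * K)" "\<bar>int (z1 k) - int (z0 k)\<bar> \<le> int (2 * (M * K))"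
          using z''(1) z1(1) by blast+
        then show "z0 k \<le> z'' k + M'"
          using RK(1) z'(3) unfolding M'_def by linarith
      qed
      then obtain n where n: "1 \<le> n" "\<bar>int n - int (z'' k)\<bar> \<le> int E" "cost_le P (real E) (z'', j) (x(k := n), j)"
        by blast
      have "\<bar>int (z'' k) - int (z' k)\<bar> \<le> int (R * K)" using z''(1) by blast
      then have "\<bar>int n - int (z' k)\<bar> \<le> int F" using n(2) F RK(1) by linarith
      moreover have "cost_le P (real F) (z', j) (x(k := n), j)"
      proof (rule cost_le_mono[OF cost_le_trans[OF z''(3) n(3)]])
        show "real (R * c) + real E \<le> real F"
          using F RK(2) unfolding of_nat_add[symmetric] of_nat_le_iff by linarith
      qed
      ultimately show ?thesis using n(1) by blast
    qed
    have "z1 k \<le> F"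
    proof -
      have "\<bar>int (z1 k) - int (z0 k)\<bar> \<le> int (2 * (M * K))" using z1(1) by blast
      then show ?thesis using z0(3) F by linarith
    qed
    moreover have "\<forall>i\<in>insert b ?\<beta>. M \<le> z1 i"
    proof
      fix i assume "i \<in> insert b ?\<beta>"
      then consider "i = b" | "i \<in> ?\<beta>" by blast
      then show "M \<le> z1 i"
      proof cases
        case 1
        then show ?thesis using z1(3) by simp
      next
        case 2
        then show ?thesis using z1_ge[OF 2] unfolding M'_def by linarith
      qed
    qed
    moreover have "\<forall>i. i \<notin> insert b ?\<beta> \<longrightarrow> z1 i = x i" using z1(2) by simp
    ultimately show "\<exists>z. (\<forall>i\<in>insert b ?\<beta>. M \<le> z i) \<and> (\<forall>i. i \<notin> insert b ?\<beta> \<longrightarrow> z i = x i) \<and>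
      z k \<le> C' * (M + 1) \<and> cost_le P (real (C' * (M + 1))) (x, j) (z, j) \<and>
      (\<forall>z'. (\<forall>i. i \<notin> insert b ?\<beta> \<longrightarrow> z' i = x i) \<longrightarrow> (\<forall>i\<in>insert b \<gamma>. \<bar>int (z' i) - int (z i)\<bar> \<le> int M) \<longrightarrow>
       z k \<le> z' k + M \<longrightarrow>
       (\<exists>n\<ge>1. \<bar>int n - int (z' k)\<bar> \<le> int (C' * (M + 1)) \<and>
          cost_le P (real (C' * (M + 1))) (z', j) (x(k := n), j)))"
      using cost1 return unfolding F_def by blast
  qed
qed

text \<open>For empty \<alpha> moving \<open>k\<close> displaces nothing else. Level
  \<open>a\<close> is changed to \<open>n\<close> first, and then one path between equal levels
  turns \<open>x\<close> into \<open>x'\<close> at a bounded cost. This corrects the endpoint of the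
  long path.\<close>

lemma level_cost:
  fixes P :: "('d::finite, 's::finite) state \<Rightarrow> ('d, 's) state \<Rightarrow> real"
  assumes P: "qbd_matrix P" and irr: "Q_star_irreducible P"
  obtains C :: nat where "\<And>a n. 1 \<le> a \<Longrightarrow> 1 \<le> n \<Longrightarrow>
    cost_le P (real (C * (nat \<bar>int a - int n\<bar> + 1))) (x(k := a), j) (x'(k := n), j)"
proof -
  obtain c K :: nat where
    up: "\<And>R z. (\<And>i. i \<in> {} \<Longrightarrow> R * K + K + 1 \<le> z i) \<Longrightarrow> (\<And>i. i \<notin> {} \<Longrightarrow> i \<noteq> k \<Longrightarrow> z i = x i) \<Longrightarrow> 1 \<le> z k \<Longrightarrow>
      \<exists>z'. (\<forall>i\<in>{}. \<bar>int (z' i) - int (z i)\<bar> \<le> int (R * K)) \<and> (\<forall>i. i \<notin> {} \<longrightarrow> i \<noteq> k \<longrightarrow> z' i = x i) \<and>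
        z' k = z k + R \<and> cost_le P (real (R * c)) (z, j) (z', j)" and
    down: "\<And>R z. (\<And>i. i \<in> {} \<Longrightarrow> R * K + K + 1 \<le> z i) \<Longrightarrow> (\<And>i. i \<notin> {} \<Longrightarrow> i \<noteq> k \<Longrightarrow> z i = x i) \<Longrightarrow> R < z k \<Longrightarrow>
      \<exists>z'. (\<forall>i\<in>{}. \<bar>int (z' i) - int (z i)\<bar> \<le> int (R * K)) \<and> (\<forall>i. i \<notin> {} \<longrightarrow> i \<noteq> k \<longrightarrow> z' i = x i) \<and>
        z' k = z k - R \<and> cost_le P (real (R * c)) (z, j) (z', j)"
    by (rule raise_lower[OF P irr, of k "{}" x j]) blast+
  obtain c' :: nat where c': "\<And>z z' t. (\<forall>i. i \<noteq> k \<longrightarrow> z i = x i \<and> z' i = x' i) \<Longrightarrow>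
       z k = 0 + t + 1 \<Longrightarrow> z' k = 0 + t + 1 \<Longrightarrow> cost_le P (real c') (z, j) (z', j)"
    using Q_star_connection[OF P irr, of k "{}" x x' 0 0 j j] by auto blast
  show ?thesis
  proof (rule that[of "c + c'"])
    fix a n :: nat assume an: "1 \<le> a" "1 \<le> n"
    define R where "R = nat \<bar>int a - int n\<bar>"
    obtain z where z: "\<forall>i. i \<noteq> k \<longrightarrow> z i = x i" "z k = n" "cost_le P (real (R * c)) (x(k := a), j) (z, j)"
    proof (cases "a \<le> n")
      case True
      then show ?thesis using up[of R "x(k := a)"] an that by (force simp: R_def)
    next
      case False
      then show ?thesis using down[of R "x(k := a)"] an that by (force simp: R_def)
    qed
    have "z = x(k := n)" using z(1,2) by auto
    then have "cost_le P (real (R * c) + real c') (x(k := a), j) (x'(k := n), j)"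
      using z(3) an by (intro cost_le_trans[OF z(3)] c'[of _ _ "n - 1"]) auto
    moreover have "R * c + c' \<le> (c + c') * (R + 1)" by (simp add: algebra_simps)
    ultimately show "cost_le P (real ((c + c') * (nat \<bar>int a - int n\<bar> + 1))) (x(k := a), j) (x'(k := n), j)"
      unfolding R_def[symmetric] by (elim cost_le_mono) (simp only: of_nat_add[symmetric] of_nat_le_iff)
  qed
qed

text \<open>Here \<open>n\<close> is a height from which the loop can be run anywhere. Leaving it
  existential makes the set closed under addition, since a sum of loops needs more room.
  \<open>L\<close> is padded with zeros outside \<beta>.\<close>

definition loop_costs ::
    "(('d::finite, 's::finite) state \<Rightarrow> ('d, 's) state \<Rightarrow> real) \<Rightarrow> 'd set \<Rightarrow> ('d \<Rightarrow> nat) \<Rightarrow> 's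
       \<Rightarrow> ((real ^ 'd) \<times> real) set" where
  "loop_costs P \<beta> x j = {(L, g). \<exists>l n. L = (\<chi> i. if i \<in> \<beta> then real_of_int (l i) else 0) \<and>
     (\<forall>z z'. (\<forall>i\<in>\<beta>. n \<le> z i \<and> int (z' i) = int (z i) + l i) \<longrightarrow>
        (\<forall>i. i \<notin> \<beta> \<longrightarrow> z i = x i \<and> z' i = x i) \<longrightarrow> cost_le P g (z, j) (z', j))}"

lemma loop_costsE:
  assumes "(L, g) \<in> loop_costs P \<beta> x j"
  obtains l n where "L = (\<chi> i. if i \<in> \<beta> then real_of_int (l i) else 0)"
    "\<And>z z'. (\<forall>i\<in>\<beta>. n \<le> z i \<and> int (z' i) = int (z i) + l i) \<Longrightarrow>
        (\<forall>i. i \<notin> \<beta> \<longrightarrow> z i = x i \<and> z' i = x i) \<Longrightarrow> cost_le P g (z, j) (z', j)"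
  using assms unfolding loop_costs_def by blast

lemma loop_costsI:
  assumes "\<And>z z'. (\<forall>i\<in>\<beta>. n \<le> z i \<and> int (z' i) = int (z i) + l i) \<Longrightarrow>
        (\<forall>i. i \<notin> \<beta> \<longrightarrow> z i = x i \<and> z' i = x i) \<Longrightarrow> cost_le P g (z, j) (z', j)"
  shows "(\<chi> i. if i \<in> \<beta> then real_of_int (l i) else 0, g) \<in> loop_costs P \<beta> x j"
  unfolding loop_costs_def mem_Collect_eq case_prod_conv
  by (rule exI[of _ l], rule exI[of _ n]) (use assms in blast)

lemma loop_costs_zero: "(0, 0) \<in> loop_costs P \<beta> x j"
proof -
  have "(\<chi> i. if i \<in> \<beta> then real_of_int 0 else 0, 0) \<in> loop_costs P \<beta> x j"
  proof (rule loop_costsI[of _ 0])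
    fix z z' :: "'a \<Rightarrow> nat"
    assume z: "\<forall>i\<in>\<beta>. 0 \<le> z i \<and> int (z' i) = int (z i) + 0" "\<forall>i. i \<notin> \<beta> \<longrightarrow> z i = x i \<and> z' i = x i"
    have "z = z'"
    proof
      fix i show "z i = z' i" using z by (cases "i \<in> \<beta>") auto
    qed
    then show "cost_le P 0 (z, j) (z', j)" by (simp add: cost_le_refl)
  qed
  moreover have "(\<chi> i. if i \<in> \<beta> then real_of_int 0 else 0) = (0 :: real ^ 'a)"
    by (simp add: vec_eq_iff)
  ultimately show ?thesis by simp
qed

lemma loop_costs_add:
  assumes a: "a \<in> loop_costs P \<beta> x j" and b: "b \<in> loop_costs P \<beta> x j"
  shows "a + b \<in> loop_costs P \<beta> x j"
proof -
  obtain L g L' g' where [simp]: "a = (L, g)" "b = (L', g')" by (cases a; cases b)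
  obtain l n where L: "L = (\<chi> i. if i \<in> \<beta> then real_of_int (l i) else 0)"
    and g: "\<And>z z'. (\<forall>i\<in>\<beta>. n \<le> z i \<and> int (z' i) = int (z i) + l i) \<Longrightarrow>
        (\<forall>i. i \<notin> \<beta> \<longrightarrow> z i = x i \<and> z' i = x i) \<Longrightarrow> cost_le P g (z, j) (z', j)"
    by (rule loop_costsE[OF a[simplified]]) blast
  obtain l' n' where L': "L' = (\<chi> i. if i \<in> \<beta> then real_of_int (l' i) else 0)"
    and g': "\<And>z z'. (\<forall>i\<in>\<beta>. n' \<le> z i \<and> int (z' i) = int (z i) + l' i) \<Longrightarrow>
        (\<forall>i. i \<notin> \<beta> \<longrightarrow> z i = x i \<and> z' i = x i) \<Longrightarrow> cost_le P g' (z, j) (z', j)"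
    by (rule loop_costsE[OF b[simplified]]) blast
  \<comment> \<open>The sum of the \<open>\<bar>l i\<bar>\<close> bounds what the first loop can
    lose, so the second one still starts at height \<open>n'\<close>.\<close>
  define m where "m = n + n' + nat (\<Sum>i\<in>UNIV. \<bar>l i\<bar>)"
  have "(\<chi> i. if i \<in> \<beta> then real_of_int (l i + l' i) else 0, g + g') \<in> loop_costs P \<beta> x j"
  proof (rule loop_costsI[of _ m])
    fix z z' :: "'a \<Rightarrow> nat"
    assume z: "\<forall>i\<in>\<beta>. m \<le> z i \<and> int (z' i) = int (z i) + (l i + l' i)"
      "\<forall>i. i \<notin> \<beta> \<longrightarrow> z i = x i \<and> z' i = x i"
    define y where "y i = (if i \<in> \<beta> then nat (int (z i) + l i) else x i)" for i
    have y: "n' \<le> y i" "int (y i) = int (z i) + l i" if "i \<in> \<beta>" for i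
    proof -
      have "\<bar>l i\<bar> \<le> (\<Sum>i\<in>UNIV. \<bar>l i\<bar>)" by (rule member_le_sum) auto
      then show "n' \<le> y i" "int (y i) = int (z i) + l i"
        using bspec[OF z(1) that] that by (auto simp: y_def m_def)
    qed
    have "cost_le P g (z, j) (y, j)"
      by (rule g) (use y z in \<open>auto simp: m_def y_def\<close>)
    moreover have "cost_le P g' (y, j) (z', j)"
      by (rule g') (use y z in \<open>auto simp: y_def\<close>)
    ultimately show "cost_le P (g + g') (z, j) (z', j)" by (rule cost_le_trans)
  qed
  moreover have "L + L' = (\<chi> i. if i \<in> \<beta> then real_of_int (l i + l' i) else 0)"
    by (simp add: L L' vec_eq_iff)
  ultimately show ?thesis by simp
qed

lemma loop_costs_nonneg:
  assumes "(L, g) \<in> loop_costs P \<beta> x j" "stochastic_mat P"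
  shows "0 \<le> g"
proof -
  obtain l n where g: "\<And>z z'. (\<forall>i\<in>\<beta>. n \<le> z i \<and> int (z' i) = int (z i) + l i) \<Longrightarrow>
        (\<forall>i. i \<notin> \<beta> \<longrightarrow> z i = x i \<and> z' i = x i) \<Longrightarrow> cost_le P g (z, j) (z', j)"
    by (rule loop_costsE[OF assms(1)]) blast
  define z where "z i = (if i \<in> \<beta> then n + nat \<bar>l i\<bar> else x i)" for i
  define z' where "z' i = (if i \<in> \<beta> then nat (int (z i) + l i) else x i)" for i
  have "cost_le P g (z, j) (z', j)"
    by (rule g) (auto simp: z_def z'_def)
  then show ?thesis using assms(2) by (rule cost_le_nonneg)
qed

text \<open>The route to level \<open>n\<close> is: raise the coordinates, run the loop
  \<open>n div N\<close> times, lower them, correct the level. \<open>C\<close> is chosen before the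
  loop and \<open>D\<close> before \<open>n\<close>; the separation argument needs the former and
  the limit the latter.\<close>

lemma path_cost:
  fixes P :: "('d::finite, 's::finite) state \<Rightarrow> ('d, 's) state \<Rightarrow> real"
  assumes P: "qbd_matrix P" and irr: "Q_star_irreducible P"
    and k: "k \<in> \<beta>" and x: "\<forall>i\<in>\<beta>. 1 \<le> x i"
  obtains C :: real where "0 \<le> C"
    "\<And>L g N. (L, g) \<in> loop_costs P \<beta> x j \<Longrightarrow> 1 \<le> N \<Longrightarrow>
       \<exists>D. \<forall>n\<ge>1. cost_le P (real (n div N) * (g + C * norm (real N *\<^sub>R axis k 1 - L)) + D) (x, j) (x'(k := n), j)"
proof -
  have ik: "insert k (\<beta> - {k}) = \<beta>" using k by auto
  have kn: "k \<notin> \<beta> - {k}" and x': "\<forall>i\<in>insert k (\<beta> - {k}). 1 \<le> x i" using x ik by simp_all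
  obtain C1 :: nat where C1: "\<forall>M. \<exists>z. (\<forall>i\<in>\<beta>. M \<le> z i) \<and> (\<forall>i. i \<notin> \<beta> \<longrightarrow> z i = x i) \<and>
    z k \<le> C1 * (M + 1) \<and> cost_le P (real (C1 * (M + 1))) (x, j) (z, j) \<and>
    (\<forall>z'. (\<forall>i. i \<notin> \<beta> \<longrightarrow> z' i = x i) \<longrightarrow> (\<forall>i\<in>\<beta> - {k}. \<bar>int (z' i) - int (z i)\<bar> \<le> int M) \<longrightarrow>
       z k \<le> z' k + M \<longrightarrow>
       (\<exists>n\<ge>1. \<bar>int n - int (z' k)\<bar> \<le> int (C1 * (M + 1)) \<and>
          cost_le P (real (C1 * (M + 1))) (z', j) (x(k := n), j)))"
    using raise_and_lower_all[OF P irr finite kn x', unfolded ik] by (rule exE)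
  obtain C2 :: nat where C2: "\<And>a n. 1 \<le> a \<Longrightarrow> 1 \<le> n \<Longrightarrow>
    cost_le P (real (C2 * (nat \<bar>int a - int n\<bar> + 1))) (x(k := a), j) (x'(k := n), j)"
    using level_cost[OF P irr] by blast
  \<comment> \<open>This is the total coefficient of \<open>W\<close>: raising and lowering cost
    \<open>C1 * (M + 1)\<close> each, and the correction costs \<open>C2\<close> per level over at
    most \<open>2 * E + W + N\<close> levels.\<close>
  define C where "C = real (2 * C1 + 2 * C1 * C2 + C2)"
  show ?thesis
  proof (rule that[of C])
    show "0 \<le> C" by (simp add: C_def)
    fix L :: "real ^ 'd" and g and N :: nat
    assume loop: "(L, g) \<in> loop_costs P \<beta> x j" and N: "1 \<le> N"
    obtain l K where L: "L = (\<chi> i. if i \<in> \<beta> then real_of_int (l i) else 0)"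
      and g: "\<And>z z'. (\<forall>i\<in>\<beta>. K \<le> z i \<and> int (z' i) = int (z i) + l i) \<Longrightarrow>
        (\<forall>i. i \<notin> \<beta> \<longrightarrow> z i = x i \<and> z' i = x i) \<Longrightarrow> cost_le P g (z, j) (z', j)"
      by (rule loop_costsE[OF loop]) blast
    define \<delta> where "\<delta> = norm (real N *\<^sub>R axis k 1 - L)"
    have \<delta>: "\<bar>real_of_int (l i)\<bar> \<le> \<delta>" if "i \<in> \<beta>" "i \<noteq> k" for i
      using component_le_norm_cart[of "real N *\<^sub>R axis k 1 - L" i] that
      by (simp add: \<delta>_def L axis_def)
    have \<delta>k: "\<bar>real_of_int (l k) - real N\<bar> \<le> \<delta>"
      using component_le_norm_cart[of "real N *\<^sub>R axis k 1 - L" k] k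
      by (simp add: \<delta>_def L axis_def abs_minus_commute)
    define D where "D = real ((2 * C1 + 2 * C1 * C2) * (K + 2) + C2 * (N + 2))"
    have "cost_le P (real (n div N) * (g + C * \<delta>) + D) (x, j) (x'(k := n), j)" if n: "1 \<le> n" for n
    proof -
      define R where "R = n div N"
      \<comment> \<open>At every stage \<open>r \<le> R\<close>, \<open>W\<close> bounds the drift
        of each coordinate of \<beta> from the ideal displacement \<open>r * N\<close> in direction
        \<open>k\<close>. Adding the height \<open>K\<close> needed by the loop gives
        \<open>M\<close>.\<close>
      define W where "W = nat \<lceil>real R * \<delta>\<rceil>"
      define M where "M = W + K"
      define E where "E = C1 * (M + 1)"
      have \<delta>0: "0 \<le> \<delta>" by (simp add: \<delta>_def)
      have W: "real R * \<delta> \<le> real W" "real W \<le> real R * \<delta> + 1"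
        using \<delta>0 by (simp_all add: W_def)
      have rW: "real r * \<delta> \<le> real W" if "r \<le> R" for r
        using W(1) mult_right_mono[OF _ \<delta>0, of "real r" "real R"] that by simp
      have rl: "\<bar>int r * l i\<bar> \<le> int W" if "r \<le> R" "i \<in> \<beta>" "i \<noteq> k" for r i
      proof -
        have "\<bar>real r * real_of_int (l i)\<bar> \<le> real r * \<delta>"
          unfolding abs_mult using \<delta>[OF that(2,3)] by (intro mult_mono) auto
        then have "real_of_int \<bar>int r * l i\<bar> \<le> real_of_int (int W)"
          using rW[OF that(1)] by simp
        then show ?thesis by (simp only: of_int_le_iff)
      qed
      have rk: "\<bar>int r * l k - int r * int N\<bar> \<le> int W" if "r \<le> R" for r
      proof -
        have "\<bar>real r * (real_of_int (l k) - real N)\<bar> \<le> real r * \<delta>"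
          unfolding abs_mult using \<delta>k by (intro mult_mono) auto
        then have "real_of_int \<bar>int r * l k - int r * int N\<bar> \<le> real_of_int (int W)"
          using rW[OF that(1)] by (simp add: right_diff_distrib)
        then show ?thesis by (simp only: of_int_le_iff)
      qed
      obtain z where z: "\<forall>i\<in>\<beta>. M \<le> z i" "\<forall>i. i \<notin> \<beta> \<longrightarrow> z i = x i" "z k \<le> E"
          "cost_le P (real E) (x, j) (z, j)"
        and z': "\<And>z'. (\<forall>i. i \<notin> \<beta> \<longrightarrow> z' i = x i) \<Longrightarrow> (\<forall>i\<in>\<beta> - {k}. \<bar>int (z' i) - int (z i)\<bar> \<le> int M) \<Longrightarrow>
          z k \<le> z' k + M \<Longrightarrow>
          (\<exists>n\<ge>1. \<bar>int n - int (z' k)\<bar> \<le> int E \<and> cost_le P (real E) (z', j) (x(k := n), j))"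
        using C1[THEN spec, of M] unfolding E_def by blast
      define f where "f r i = (if i \<in> \<beta> then nat (int (z i) + int r * l i) else x i)" for r i
      have f: "int (f r i) = int (z i) + int r * l i" "K \<le> f r i" if "r \<le> R" "i \<in> \<beta>" for r i
      proof -
        \<comment> \<open>For \<open>k\<close> the ideal displacement is upwards, so only the
          deviation from it can lose height.\<close>
        have "- int W \<le> int r * l i"
        proof (cases "i = k")
          case True
          have "0 \<le> int r * int N" by simp
          then have "- int W \<le> int r * l k" using rk[OF that(1)] by linarith
          then show ?thesis using True by simp
        next
          case False
          then show ?thesis using rl[OF that] by linarith
        qed
        moreover have "int W + int K \<le> int (z i)" using bspec[OF z(1) that(2)] by (simp add: M_def)
        ultimately have "int K \<le> int (z i) + int r * l i" by linarith
        then show "int (f r i) = int (z i) + int r * l i" "K \<le> f r i"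
          using that(2) by (simp_all add: f_def le_nat_iff)
      qed
      have f_off: "\<forall>i. i \<notin> \<beta> \<longrightarrow> f r i = x i" for r by (simp add: f_def)
      have "cost_le P (real R * g) (f 0, j) (f R, j)"
      proof (rule cost_le_iterate[where f = "\<lambda>r. (f r, j)"])
        fix r assume r: "r < R"
        show "cost_le P g (f r, j) (f (Suc r), j)"
        proof (rule g)
          show "\<forall>i\<in>\<beta>. K \<le> f r i \<and> int (f (Suc r) i) = int (f r i) + l i"
            using f[of r] f[of "Suc r"] r by (auto simp: algebra_simps)
        qed (use f_off in auto)
      qed
      moreover have "f 0 = z" using z(2) by (auto simp: f_def)
      ultimately have cost2: "cost_le P (real R * g) (z, j) (f R, j)" by simp
      have "\<exists>n\<ge>1. \<bar>int n - int (f R k)\<bar> \<le> int E \<and> cost_le P (real E) (f R, j) (x(k := n), j)"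
      proof (rule z'[OF f_off])
        show "\<forall>i\<in>\<beta> - {k}. \<bar>int (f R i) - int (z i)\<bar> \<le> int M"
        proof
          fix i assume "i \<in> \<beta> - {k}"
          then show "\<bar>int (f R i) - int (z i)\<bar> \<le> int M"
            using f(1)[of R i] rl[of R i] by (simp add: M_def)
        qed
        have "0 \<le> int R * int N" by simp
        then show "z k \<le> f R k + M"
          using f(1)[of R k] rk[of R] k unfolding M_def by linarith
      qed
      then obtain a where a: "1 \<le> a" "\<bar>int a - int (f R k)\<bar> \<le> int E" "cost_le P (real E) (f R, j) (x(k := a), j)"
        by blast
      define V where "V = nat \<bar>int a - int n\<bar>"
      have "int n = int R * int N + int (n mod N)"
        unfolding R_def by (simp flip: of_nat_mult of_nat_add)
      moreover have "n mod N \<le> N" using N by (simp add: less_imp_le)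
      ultimately have V: "V \<le> 2 * E + W + N"
        using a(2) f(1)[of R k] rk[of R] k z(3) unfolding V_def by linarith
      have total: "cost_le P (real E + real R * g + real E + real (C2 * (V + 1))) (x, j) (x'(k := n), j)"
        unfolding V_def
        by (rule cost_le_trans[OF cost_le_trans[OF cost_le_trans[OF z(4) cost2] a(3)] C2[OF a(1) n]])
      have "real (C2 * (V + 1)) \<le> real (C2 * (2 * E + W + N + 1))"
        using V by (intro of_nat_mono mult_left_mono) auto
      then have "real E + real R * g + real E + real (C2 * (V + 1)) \<le>
          real R * g + (2 * real C1 + 2 * real C1 * real C2) * (real W + real K + 1) + real C2 * (real W + real N + 1)"
        by (simp add: E_def M_def algebra_simps)
      also have "\<dots> \<le> real R * g + (2 * real C1 + 2 * real C1 * real C2) * (real R * \<delta> + real K + 2)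
          + real C2 * (real R * \<delta> + real N + 2)"
        by (rule add_mono[OF add_mono[OF order_refl mult_left_mono] mult_left_mono]) (use W(2) in auto)
      also have "\<dots> = real R * (g + C * \<delta>) + D"
        by (simp add: C_def D_def algebra_simps)
      finally show ?thesis
        using cost_le_mono[OF total] unfolding R_def by blast
    qed
    then show "\<exists>D. \<forall>n\<ge>1. cost_le P (real (n div N) * (g + C * norm (real N *\<^sub>R axis k 1 - L)) + D) (x, j) (x'(k := n), j)"
      unfolding \<delta>_def by blast
  qed
qed

section \<open>The lower bound\<close>

lemma liminf_ge_of_linear_bound:
  assumes "0 \<le> s" "1 \<le> N" and lower: "\<And>n. 1 \<le> n \<Longrightarrow> c - real (n div N) * s \<le> a n"
  shows "ereal (- (s / real N)) \<le> liminf (\<lambda>n. ereal (a n / real n))"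
proof -
  have "(\<lambda>n. - (s / real N) + c * inverse (real n)) \<longlonglongrightarrow> - (s / real N) + c * 0"
    by (intro tendsto_intros lim_inverse_n)
  then have "liminf (\<lambda>n. ereal (- (s / real N) + c * inverse (real n))) = ereal (- (s / real N))"
    by (intro lim_imp_Liminf) auto
  moreover have "\<forall>\<^sub>F n in sequentially. ereal (- (s / real N) + c * inverse (real n)) \<le> ereal (a n / real n)"
  proof (rule eventually_sequentiallyI[of 1])
    fix n :: nat assume n: "1 \<le> n"
    have "real (n div N) * s \<le> real n / real N * s"
      using assms(1) by (intro mult_right_mono of_nat_div_le_of_nat)
    then have "c - real n / real N * s \<le> a n" using lower[OF n] by linarith
    then have "(c - real n / real N * s) / real n \<le> a n / real n"
      by (rule divide_right_mono) simp
    moreover have "(c - real n / real N * s) / real n = - (s / real N) + c * inverse (real n)"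
      using n by (simp add: field_simps)
    ultimately show "ereal (- (s / real N) + c * inverse (real n)) \<le> ereal (a n / real n)" by simp
  qed
  ultimately show ?thesis by (metis Liminf_mono)
qed

text \<open>Any transition in \<open>n\<close> steps that restores the coordinates outside \<beta>
  and the phase is itself a loop, with cost minus the logarithm of its probability \<open>q\<close>.
  The inequality for \<theta> is then exactly the bound required by
  \<open>Gamma_barI\<close>.\<close>

lemma Gamma_bar_of_loop_costs:
  fixes P :: "('d::finite, 's::finite) state \<Rightarrow> ('d, 's) state \<Rightarrow> real"
  assumes P: "qbd_matrix P" and irr: "Q_star_irreducible P" and k: "k \<in> \<beta>"
    and \<theta>: "\<And>L g. (L, g) \<in> loop_costs P \<beta> x j \<Longrightarrow> \<theta> \<bullet> L \<le> g"
  shows "\<theta> \<in> Gamma_bar P \<beta>"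
proof (rule Gamma_barI[OF P, where x = x and j = j])
  show "irreducible_mat (indices (- \<beta>)) (P_star P \<beta> \<theta>)"
    by (rule irreducible_P_star[OF P k irr[unfolded Q_star_irreducible_def, rule_format]]) simp
  fix n and z z' :: "'d \<Rightarrow> nat"
  assume z: "\<And>i. i \<in> \<beta> \<Longrightarrow> n + 1 \<le> z i" "\<And>i. i \<notin> \<beta> \<Longrightarrow> z i = x i \<and> z' i = x i"
  define p where "p = mat_pow UNIV P n (z, j) (z', j)"
  define l where "l i = int (z' i) - int (z i)" for i
  let ?s = "\<Sum>i\<in>\<beta>. (real (z' i) - real (z i)) * \<theta> $ i"
  have "p \<le> 1" unfolding p_def by (rule mat_pow_stochastic_le_1[OF qbd_stochastic[OF P]])
  then obtain q where q: "p = ennreal q" "0 \<le> q" by (cases p) (auto simp: top_unique)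
  show "mat_pow UNIV P n (z, j) (z', j) \<le> ennreal (exp (- ?s))"
  proof (cases "q = 0")
    case True
    then show ?thesis using q by (simp add: p_def)
  next
    case False
    with q have q0: "0 < q" by simp
    have "(\<chi> i. if i \<in> \<beta> then real_of_int (l i) else 0, - ln q) \<in> loop_costs P \<beta> x j"
    proof (rule loop_costsI[of _ "n + 1"])
      fix y y' :: "'d \<Rightarrow> nat"
      assume y: "\<forall>i\<in>\<beta>. n + 1 \<le> y i \<and> int (y' i) = int (y i) + l i" "\<forall>i. i \<notin> \<beta> \<longrightarrow> y i = x i \<and> y' i = x i"
      have "p \<le> mat_pow UNIV P n (y, j) (y', j)"
        unfolding p_def
      proof (rule mat_pow_shift_le[OF P, of \<beta>])
        fix i
        show "n + 1 \<le> z i \<and> n + 1 \<le> y i" if "i \<in> \<beta>" using that y z by blast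
        show "y i = z i" if "i \<notin> \<beta>" using that y z by simp
        show "int (y' i) - int (y i) = int (z' i) - int (z i)"
          using y z by (cases "i \<in> \<beta>") (auto simp: l_def)
      qed
      then show "cost_le P (- ln q) (y, j) (y', j)"
        unfolding cost_le_def using q q0 by (intro exI[of _ n]) simp
    qed
    then have "\<theta> \<bullet> (\<chi> i. if i \<in> \<beta> then real_of_int (l i) else 0) \<le> - ln q" by (rule \<theta>)
    moreover have "\<theta> \<bullet> (\<chi> i. if i \<in> \<beta> then real_of_int (l i) else 0) = ?s"
      by (simp add: inner_vec_def l_def if_distrib[of "\<lambda>t. _ * t"] sum.If_cases mult.commute cong: if_cong)
    ultimately have "ln q \<le> - ?s" by linarith
    then have "q \<le> exp (- ?s)" using q0 by (metis exp_le_cancel_iff exp_ln)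
    then show ?thesis using q by (simp add: p_def[symmetric] ennreal_leI)
  qed
qed

theorem theorem3p1:
  fixes M :: "('d::finite, 's::finite) state \<Rightarrow> 'w measure"
    and Y :: "nat \<Rightarrow> 'w \<Rightarrow> ('d, 's) state"
    and P :: "('d, 's) state \<Rightarrow> ('d, 's) state \<Rightarrow> real"
    and \<nu> :: "('d, 's) state \<Rightarrow> real"
  assumes "qbd_matrix P"
    and "markov_chain M Y P"
    and "irreducible_mat UNIV P"
    and "positive_recurrent M Y"
    and "stationary_distribution P \<nu>"
    and "\<And>k. irreducible_mat (UNIV \<times> indices (- {k})) (Q_mat P k)"
    and "\<And>\<alpha> k. 1 \<le> card \<alpha> \<Longrightarrow> card \<alpha> \<le> CARD('d) - 1 \<Longrightarrow> k \<notin> \<alpha> \<Longrightarrow>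
           irreducible_mat (UNIV \<times> indices (- \<alpha> - {k})) (Q_star P \<alpha> k 0)"
  shows "\<forall>k \<alpha> x j. \<alpha> \<subseteq> - {k} \<longrightarrow>
           liminf (\<lambda>n. ereal (ln (\<nu> (x(k := n), j)) / real n))
             \<ge> - (SUP \<theta>\<in>Gamma_bar P ({k} \<union> \<alpha>). ereal (\<theta> $ k))"
proof (intro allI impI)
  fix k :: 'd and \<alpha> and x :: "'d \<Rightarrow> nat" and j :: 's
  note P = \<open>qbd_matrix P\<close>
  note stoch = qbd_stochastic[OF P]
  define \<beta> where "\<beta> = {k} \<union> \<alpha>"
  \<comment> \<open>A starting point with positive coordinates in \<beta>, from which they can be
    raised. Changing the start affects only the constant \<open>ln (\<nu> (y, j))\<close>, which
    vanishes after division by n.\<close>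
  define y where "y i = (if i \<in> \<beta> then 1 else x i)" for i
  let ?lim = "liminf (\<lambda>n. ereal (ln (\<nu> (x(k := n), j)) / real n))"
  let ?S = "SUP \<theta>\<in>Gamma_bar P \<beta>. ereal (\<theta> $ k)"
  have irr: "Q_star_irreducible P"
    unfolding Q_star_irreducible_def
  proof (intro allI impI)
    fix \<gamma> :: "'d set" and i assume i: "i \<notin> \<gamma>"
    show "irreducible_mat (UNIV \<times> indices (- \<gamma> - {i})) (Q_star P \<gamma> i 0)"
    proof (cases "\<gamma> = {}")
      case True
      \<comment> \<open>For empty \<alpha> the sum has a single empty jump with weight exp 0 =
        1.\<close>
      have "P_star P {} 0 = P" by (auto simp: P_star_def fun_eq_iff)
      then have "Q_star P {} i 0 = Q_mat P i" by (simp add: Q_star_def Q_mat_def)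
      then show ?thesis using assms(6)[of i] True by (simp add: Compl_eq_Diff_UNIV)
    next
      case False
      have "card \<gamma> < CARD('d)" using i by (intro psubset_card_mono) auto
      then show ?thesis
        using False i by (intro assms(7)) (auto simp: Suc_le_eq card_gt_0_iff)
    qed
  qed
  have k: "k \<in> \<beta>" by (simp add: \<beta>_def)
  obtain C where C: "0 \<le> C"
    "\<And>L g N. (L, g) \<in> loop_costs P \<beta> y j \<Longrightarrow> 1 \<le> N \<Longrightarrow>
       \<exists>D. \<forall>n\<ge>1. cost_le P (real (n div N) * (g + C * norm (real N *\<^sub>R axis k 1 - L)) + D) (y, j) (x(k := n), j)"
    using path_cost[OF P irr k, of y j x] by (auto simp: y_def)
  have lower: "ereal (- ((g + C * norm (real N *\<^sub>R axis k 1 - L)) / real N)) \<le> ?lim"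
    if loop: "(L, g) \<in> loop_costs P \<beta> y j" and N: "1 \<le> N" for L g N
  proof -
    define s where "s = g + C * norm (real N *\<^sub>R axis k 1 - L)"
    obtain D where D: "\<And>n. 1 \<le> n \<Longrightarrow> cost_le P (real (n div N) * s + D) (y, j) (x(k := n), j)"
      using C(2)[OF loop N] unfolding s_def by blast
    have "0 \<le> s" using loop_costs_nonneg[OF loop stoch] C(1) by (simp add: s_def)
    moreover have "(ln (\<nu> (y, j)) - D) - real (n div N) * s \<le> ln (\<nu> (x(k := n), j))" if "1 \<le> n" for n
      using stationary_cost_le[OF stoch assms(5,3) D[OF that]] by simp
    ultimately show ?thesis
      unfolding s_def[symmetric] using N by (intro liminf_ge_of_linear_bound)
  qed
  have "- ?S \<le> ?lim"
  \<comment> \<open>Two reals are inserted into the gap because the separation needs \<sigma> <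
    \<rho> strictly. As they are real, infinite values of the supremum or of the limit inferior need
    no separate treatment.\<close>
  proof (rule ccontr)
    assume "\<not> ?thesis"
    then have "?S < - ?lim" by (simp add: not_le ereal_less_uminus_reorder)
    then obtain \<sigma> where \<sigma>: "?S < ereal \<sigma>" "ereal \<sigma> < - ?lim" using ereal_dense2 by blast
    then obtain \<rho> where \<rho>: "ereal \<sigma> < ereal \<rho>" "ereal \<rho> < - ?lim" using ereal_dense2 by blast
    have "\<exists>\<theta>. (\<forall>(L, g)\<in>loop_costs P \<beta> y j. \<theta> \<bullet> L \<le> g) \<and> \<sigma> < \<theta> \<bullet> axis k 1"
    proof (rule exists_linear_minorant[where C = C and \<rho> = \<rho>])
      show "\<rho> * real N \<le> g + C * norm (real N *\<^sub>R axis k 1 - L)"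
        if "(L, g) \<in> loop_costs P \<beta> y j" "1 \<le> N" for L g N
      proof -
        have "?lim < ereal (- \<rho>)" using \<rho>(2) unfolding ereal_less_uminus_reorder[of "ereal \<rho>"] uminus_ereal.simps .
        with lower[OF that] have "ereal (- ((g + C * norm (real N *\<^sub>R axis k 1 - L)) / real N)) < ereal (- \<rho>)"
          by (rule le_less_trans)
        then have "\<rho> < (g + C * norm (real N *\<^sub>R axis k 1 - L)) / real N"
          unfolding less_ereal.simps by linarith
        then show ?thesis using that(2) by (simp add: pos_less_divide_eq less_imp_le)
      qed
    qed (use \<rho>(1) C(1) in \<open>auto intro: loop_costs_zero loop_costs_add\<close>)
    then obtain \<theta> where \<theta>: "\<And>L g. (L, g) \<in> loop_costs P \<beta> y j \<Longrightarrow> \<theta> \<bullet> L \<le> g" "\<sigma> < \<theta> $ k"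
      by (auto simp: inner_axis)
    have "\<theta> \<in> Gamma_bar P \<beta>" by (rule Gamma_bar_of_loop_costs[OF P irr k \<theta>(1)])
    then have "ereal (\<theta> $ k) \<le> ?S" by (rule SUP_upper)
    also have "\<dots> < ereal \<sigma>" by (rule \<sigma>(1))
    finally show False using \<theta>(2) by simp
  qed
  then show "- (SUP \<theta>\<in>Gamma_bar P ({k} \<union> \<alpha>). ereal (\<theta> $ k)) \<le> ?lim"
    by (simp add: \<beta>_def)
qed

end
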